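(* Let $\ell\mathsf{AG}$ be the variety of Abelian $\ell$-groups, let $\mathcal F=\{f_n:n\in\mathbb Z^+\}$, where $f_n$ is the unary implicit operation of $\ell\mathsf{AG}$ of "dividing by $n$" (defined by the equation $x\approx ny$), let $\mathscr L_{\mathcal F}$ be an $\mathcal F$-expansion of the language of $\ell\mathsf{AG}$, and let $\ell\mathsf{DAG}=\mathbb S(\ell\mathsf{AG}[\mathscr L_{\mathcal F}])$. Then $\ell\mathsf{DAG}$ is a variety and an equational Beth companion of $\ell\mathsf{AG}$.
   Context: An Abelian $\ell$-group is an algebra $\langle A;+,-,\wedge,\vee,0\rangle$ such that $\langle A;+,-,0\rangle$ is an Abelian group, $\langle A;\wedge,\vee\rangle$ is a lattice, and $a\le b$ implies $a+c\le b+c$ for all $a,b,c\in A$. For $\mathbf A\in\ell\mathsf{AG}$, $f_n^{\mathbf A}$ has domain $\{c\in A:nb=c\text{ for some }b\in A\}$ and maps $c$ to the unique $b$ with $nb=c$. Algebras are nonempty structures in a language with function symbols (including constants) only; a class of algebras $\mathsf K$ consists of algebras in a common language $\mathscr L_{\mathsf K}$; ${\upharpoonright}_{\mathscr L}$ denotes reducts to $\mathscr L$. Formulas are first-order formulas with equality. A pp formula is one of the form $\exists x_1,\dots,x_k\,\varphi$ with $\varphi$ a finite conjunction of equations (the empty one being $\top$). A variety is a class closed under homomorphic images, subalgebras, and direct products. Implicit operations. An $n$-ary partial function on a class $\mathsf{K}$ is a sequence $f=\langle f^{\mathbf A}:\mathbf A\in\mathsf K\rangle$ where each $f^{\mathbf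 A}$ is a function from a subset $\mathrm{dom}(f^{\mathbf A})\subseteq A^n$ to $A$. A formula $\varphi(x_1,\dots,x_n,y)$ with $n\ge 1$ is functional in $\mathsf K$ when for all $\mathbf A\in\mathsf K$ and $a_1,\dots,a_n\in A$ there is at most one $b\in A$ with $\mathbf A\vDash\varphi(a_1,\dots,a_n,b)$; it then defines the partial function whose $\mathbf A$-component is defined exactly at the tuples for which such a $b$ exists, with value $b$. An implicit operation of $\mathsf K$ is a partial function $f$ on $\mathsf K$ that is defined by some formula functional in $\mathsf K$ and is preserved by homomorphisms: for every homomorphism $h\colon\mathbf A\to\mathbf B$ with $\mathbf A,\mathbf B\in\mathsf K$ and $\vec a\in\mathrm{dom}(f^{\mathbf A})$ we have $h(\vec a)\in\mathrm{dom}(f^{\mathbf B})$ and $h(f^{\mathbf A}(\vec a))=f^{\mathbf B}(h(\vec a))$. It is extendable when for all $\mathbf A\in\mathsf K$ and $\vec a\in A^n$ there is $\mathbf B\in\mathsf K$ with $\mathbf A\le\mathbf B$ and $\vec a\in\mathrm{dom}(f^{\mathbf B})$. $\mathrm{ext}_{pp}(\mathsf K)$ (resp. $\mathrm{ext}_{eq}(\mathsf K)$) is the set of extendable implicit operations of $\mathsf K$ defined by pp formulas (resp. by conjunctions of equations). pp expansions and Beth companions. For $\mathcal F\subseteq\mathrm{ext}_{pp}(\mathsf K)$, an $\mathcal F$-expansion of $\mathscr L_{\mathsf K}$ is a language $\mathscr L_{\mathcal F}=\mathscr L_{\mathsf K}\cup\{g_f:f\in\mathcal F\}$ where $g_f$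 is a new function symbol of the same arity as $f$. For $\mathbf A\in\mathsf K$ with $f^{\mathbf A}$ total for all $f\in\mathcal F$, $\mathbf A[\mathscr L_{\mathcal F}]$ is the $\mathscr L_{\mathcal F}$-algebra with $\mathscr L_{\mathsf K}$-reduct $\mathbf A$ in which each $g_f$ is interpreted as $f^{\mathbf A}$; $\mathsf K[\mathscr L_{\mathcal F}]$ is the class of all such algebras. A pp expansion of $\mathsf K$ is a class of the form $\mathbb S(\mathsf K[\mathscr L_{\mathcal F}])$ ($\mathbb S$ = class of subalgebras) for some such $\mathcal F$ and $\mathscr L_{\mathcal F}$; it is equational when it is induced in this way by some $\mathcal F\subseteq\mathrm{ext}_{eq}(\mathsf K)$. A pp expansion $\mathsf M$ of $\mathsf K$ is a Beth companion of $\mathsf K$ when for every $n$-ary implicit operation $f$ of $\mathsf K$ there is a set $T$ of terms $t(x_1,\dots,x_n)$ of $\mathsf M$ such that for all $\mathbf A\in\mathsf M$ and $\vec a\in\mathrm{dom}(f^{\mathbf A{\upharpoonright}_{\mathscr L_{\mathsf K}}})$ there is $t\in T$ with $f^{\mathbf A{\upharpoonright}_{\mathscr L_{\mathsf K}}}(\vec a)=t^{\mathbf A}(\vec a)$. An equational Beth companion is a Beth companion that is equational as a pp expansion. *)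

theory Defs
  imports Main "HOL-Library.FuncSet" "HOL-Library.Equipollence"
begin

section \<open>Languages, algebras, homomorphisms\<close>

type_synonym 'f lang = "'f \<Rightarrow> nat option"

datatype 'f trm = Var nat | Fn 'f "'f trm list"

record ('f, 'u) alg =
  carrier :: "'u set"
  interp :: "'f \<Rightarrow> 'u list \<Rightarrow> 'u"

text \<open>Operations are extensional (\<open>undefined\<close> outside their domain), so that equality of records
  is equality of algebras.\<close>

definition algebra :: "'f lang \<Rightarrow> ('f, 'u) alg \<Rightarrow> bool" where
  "algebra L A \<longleftrightarrow> carrier A \<noteq> {} \<and>
     (\<forall>s xs. (L s = Some (length xs) \<and> set xs \<subseteq> carrier A \<longrightarrow> interp A s xs \<in> carrier A) \<and>
             (\<not> (L s = Some (length xs) \<and> set xs \<subseteq> carrier A) \<longrightarrow> interp A s xs = undefined))"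

definition hom :: "'f lang \<Rightarrow> ('f, 'u) alg \<Rightarrow> ('f, 'v) alg \<Rightarrow> ('u \<Rightarrow> 'v) set" where
  "hom L A B = {h. h ` carrier A \<subseteq> carrier B \<and>
     (\<forall>s xs. L s = Some (length xs) \<and> set xs \<subseteq> carrier A \<longrightarrow>
        h (interp A s xs) = interp B s (map h xs))}"

definition isomorphic :: "'f lang \<Rightarrow> ('f, 'u) alg \<Rightarrow> ('f, 'v) alg \<Rightarrow> bool" where
  "isomorphic L A B \<longleftrightarrow> (\<exists>h \<in> hom L A B. bij_betw h (carrier A) (carrier B))"

definition subalgebra :: "'f lang \<Rightarrow> ('f, 'u) alg \<Rightarrow> ('f, 'u) alg \<Rightarrow> bool" where
  "subalgebra L A B \<longleftrightarrow> algebra L A \<and> algebra L B \<and> carrier A \<subseteq> carrier B \<and>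
     (\<forall>s xs. L s = Some (length xs) \<and> set xs \<subseteq> carrier A \<longrightarrow> interp A s xs = interp B s xs)"

definition prod_alg :: "'f lang \<Rightarrow> 'i set \<Rightarrow> ('i \<Rightarrow> ('f, 'u) alg) \<Rightarrow> ('f, 'i \<Rightarrow> 'u) alg" where
  "prod_alg L I A =
    \<lparr>carrier = (\<Pi>\<^sub>E i\<in>I. carrier (A i)),
     interp = (\<lambda>s xs. if L s = Some (length xs) \<and> set xs \<subseteq> (\<Pi>\<^sub>E i\<in>I. carrier (A i))
                      then (\<lambda>i\<in>I. interp (A i) s (map (\<lambda>x. x i) xs)) else undefined)\<rparr>"

definition reduct :: "'f lang \<Rightarrow> ('f, 'u) alg \<Rightarrow> ('f, 'u) alg" where
  "reduct L A = A\<lparr>interp := (\<lambda>s xs. if s \<in> dom L then interp A s xs else undefined)\<rparr>"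

section \<open>Classes of algebras\<close>

text \<open>A class of algebras is a set of algebras whose carriers are subsets of a type \<open>'u\<close>, which plays
  the role of the set-theoretic universe and is a type variable throughout. As in set theory, where
  a carrier is a set and the universe is not, carriers have smaller cardinality than \<open>'u\<close>.
  In particular the complement of a carrier in an infinite \<open>'u\<close> is as large as \<open>'u\<close>, which leaves room
  for extensions.
  Classes of small algebras contain all copies on \<open>'u\<close> of a carrier, so no closure under
  isomorphism has to be added to the operators below.\<close>

definition small_algebras :: "'f lang \<Rightarrow> ('f, 'u) alg set" where
  "small_algebras L = {A. algebra L A \<and> carrier A \<prec> (UNIV :: 'u set)}"

definition Sub :: "'f lang \<Rightarrow> ('f, 'u) alg set \<Rightarrow> ('f, 'u) alg set" where
  "Sub L K = {A. \<exists>B\<in>K. subalgebra L A B}"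

definition Him :: "'f lang \<Rightarrow> ('f, 'u) alg set \<Rightarrow> ('f, 'u) alg set" where
  "Him L K = {B. algebra L B \<and> (\<exists>A\<in>K. \<exists>h \<in> hom L A B. h ` carrier A = carrier B)}"

text \<open>The elements of a product are functions, hence not of type \<open>'u\<close>; a class contains the product
  when it contains its copies on \<open>'u\<close>. A product that fits into the universe has at most
  \<open>|'u|\<close> nontrivial factors, so index sets from \<open>'u\<close> suffice.\<close>

definition Prod :: "'f lang \<Rightarrow> ('f, 'u) alg set \<Rightarrow> ('f, 'u) alg set" where
  "Prod L K = {B \<in> small_algebras L. \<exists>(I :: 'u set) A. (\<forall>i\<in>I. A i \<in> K) \<and>
     isomorphic L B (prod_alg L I A)}"

definition variety :: "'f lang \<Rightarrow> ('f, 'u) alg set \<Rightarrow> bool" where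
  "variety L K \<longleftrightarrow> K \<subseteq> small_algebras L \<and> Him L K \<subseteq> K \<and> Sub L K \<subseteq> K \<and> Prod L K \<subseteq> K"

section \<open>Terms and first-order formulas\<close>

fun wf_trm :: "'f lang \<Rightarrow> nat set \<Rightarrow> 'f trm \<Rightarrow> bool" where
  "wf_trm L V (Var i) \<longleftrightarrow> i \<in> V"
| "wf_trm L V (Fn s ts) \<longleftrightarrow> L s = Some (length ts) \<and> (\<forall>t\<in>set ts. wf_trm L V t)"

fun eval :: "('f, 'u) alg \<Rightarrow> (nat \<Rightarrow> 'u) \<Rightarrow> 'f trm \<Rightarrow> 'u" where
  "eval A e (Var i) = e i"
| "eval A e (Fn s ts) = interp A s (map (eval A e) ts)"

datatype 'f fm = Top | Eq "'f trm" "'f trm" | Neg "'f fm" | And "'f fm" "'f fm" | Exi nat "'f fm"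

text \<open>\<open>wf_fm L V \<phi>\<close>: \<open>\<phi>\<close> is a formula of \<open>L\<close> with free variables in \<open>V\<close>.\<close>

fun wf_fm :: "'f lang \<Rightarrow> nat set \<Rightarrow> 'f fm \<Rightarrow> bool" where
  "wf_fm L V Top \<longleftrightarrow> True"
| "wf_fm L V (Eq s t) \<longleftrightarrow> wf_trm L V s \<and> wf_trm L V t"
| "wf_fm L V (Neg \<phi>) \<longleftrightarrow> wf_fm L V \<phi>"
| "wf_fm L V (And \<phi> \<psi>) \<longleftrightarrow> wf_fm L V \<phi> \<and> wf_fm L V \<psi>"
| "wf_fm L V (Exi v \<phi>) \<longleftrightarrow> wf_fm L (insert v V) \<phi>"

fun sat :: "('f, 'u) alg \<Rightarrow> (nat \<Rightarrow> 'u) \<Rightarrow> 'f fm \<Rightarrow> bool" where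
  "sat A e Top \<longleftrightarrow> True"
| "sat A e (Eq s t) \<longleftrightarrow> eval A e s = eval A e t"
| "sat A e (Neg \<phi>) \<longleftrightarrow> \<not> sat A e \<phi>"
| "sat A e (And \<phi> \<psi>) \<longleftrightarrow> sat A e \<phi> \<and> sat A e \<psi>"
| "sat A e (Exi v \<phi>) \<longleftrightarrow> (\<exists>a\<in>carrier A. sat A (e(v := a)) \<phi>)"

fun conj_eqs :: "'f fm \<Rightarrow> bool" where
  "conj_eqs Top \<longleftrightarrow> True"
| "conj_eqs (Eq s t) \<longleftrightarrow> True"
| "conj_eqs (And \<phi> \<psi>) \<longleftrightarrow> conj_eqs \<phi> \<and> conj_eqs \<psi>"
| "conj_eqs _ \<longleftrightarrow> False"

fun pp_fm :: "'f fm \<Rightarrow> bool" where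
  "pp_fm (Exi v \<phi>) \<longleftrightarrow> pp_fm \<phi>"
| "pp_fm \<phi> \<longleftrightarrow> conj_eqs \<phi>"

text \<open>The assignment of a tuple to the variables \<open>0, 1, \<dots>\<close>; other variables do not matter.\<close>

definition asg :: "'u list \<Rightarrow> nat \<Rightarrow> 'u" where
  "asg xs i = (if i < length xs then xs ! i else undefined)"

section \<open>Implicit operations\<close>

definition tuples :: "('f, 'u) alg \<Rightarrow> nat \<Rightarrow> 'u list set" where
  "tuples A n = {as. length as = n \<and> set as \<subseteq> carrier A}"

text \<open>An \<open>n\<close>-ary partial function on a class; the component at an algebra outside the class is
  empty, so that equality of records is equality of partial functions on the class.\<close>

record ('f, 'u) pfun =
  arity :: nat
  component :: "('f, 'u) alg \<Rightarrow> 'u list \<rightharpoonup> 'u"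

text \<open>In \<open>\<phi>(x\<^sub>1, \<dots>, x\<^sub>n, y)\<close> the variable \<open>x\<^sub>i\<close> is \<open>Var (i - 1)\<close> and \<open>y\<close> is \<open>Var n\<close>.\<close>

definition functional_fm :: "'f lang \<Rightarrow> ('f, 'u) alg set \<Rightarrow> nat \<Rightarrow> 'f fm \<Rightarrow> bool" where
  "functional_fm L K n \<phi> \<longleftrightarrow> n \<ge> 1 \<and> wf_fm L {..n} \<phi> \<and>
     (\<forall>A\<in>K. \<forall>as\<in>tuples A n. \<forall>b\<in>carrier A. \<forall>c\<in>carrier A.
        sat A (asg (as @ [b])) \<phi> \<and> sat A (asg (as @ [c])) \<phi> \<longrightarrow> b = c)"

definition defined_pfun :: "('f, 'u) alg set \<Rightarrow> nat \<Rightarrow> 'f fm \<Rightarrow> ('f, 'u) pfun" where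
  "defined_pfun K n \<phi> =
    \<lparr>arity = n,
     component = (\<lambda>A as. if A \<in> K \<and> as \<in> tuples A n \<and> (\<exists>b\<in>carrier A. sat A (asg (as @ [b])) \<phi>)
                    then Some (THE b. b \<in> carrier A \<and> sat A (asg (as @ [b])) \<phi>) else None)\<rparr>"

definition pfun_defined_by :: "'f lang \<Rightarrow> ('f, 'u) alg set \<Rightarrow> 'f fm \<Rightarrow> ('f, 'u) pfun \<Rightarrow> bool" where
  "pfun_defined_by L K \<phi> f \<longleftrightarrow> functional_fm L K (arity f) \<phi> \<and> f = defined_pfun K (arity f) \<phi>"

definition preserved_by_homs :: "'f lang \<Rightarrow> ('f, 'u) alg set \<Rightarrow> ('f, 'u) pfun \<Rightarrow> bool" where
  "preserved_by_homs L K f \<longleftrightarrow> (\<forall>A\<in>K. \<forall>B\<in>K. \<forall>h \<in> hom L A B. \<forall>as b.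
     component f A as = Some b \<longrightarrow> component f B (map h as) = Some (h b))"

definition implicit_operation :: "'f lang \<Rightarrow> ('f, 'u) alg set \<Rightarrow> ('f, 'u) pfun \<Rightarrow> bool" where
  "implicit_operation L K f \<longleftrightarrow> (\<exists>\<phi>. pfun_defined_by L K \<phi> f) \<and> preserved_by_homs L K f"

definition extendable :: "'f lang \<Rightarrow> ('f, 'u) alg set \<Rightarrow> ('f, 'u) pfun \<Rightarrow> bool" where
  "extendable L K f \<longleftrightarrow> (\<forall>A\<in>K. \<forall>as\<in>tuples A (arity f).
     \<exists>B\<in>K. subalgebra L A B \<and> as \<in> dom (component f B))"

definition ext_pp :: "'f lang \<Rightarrow> ('f, 'u) alg set \<Rightarrow> ('f, 'u) pfun set" where
  "ext_pp L K = {f. implicit_operation L K f \<and> extendable L K f \<and> (\<exists>\<phi>. pp_fm \<phi> \<and> pfun_defined_by L K \<phi> f)}"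

definition ext_eq :: "'f lang \<Rightarrow> ('f, 'u) alg set \<Rightarrow> ('f, 'u) pfun set" where
  "ext_eq L K = {f. implicit_operation L K f \<and> extendable L K f \<and> (\<exists>\<phi>. conj_eqs \<phi> \<and> pfun_defined_by L K \<phi> f)}"

section \<open>pp expansions and Beth companions\<close>

text \<open>\<open>g f\<close> is the new function symbol for \<open>f \<in> F\<close>, and \<open>LF\<close> the expanded language.\<close>

definition expansion ::
  "'f lang \<Rightarrow> ('f, 'u) pfun set \<Rightarrow> (('f, 'u) pfun \<Rightarrow> 'f) \<Rightarrow> 'f lang \<Rightarrow> bool" where
  "expansion L F g LF \<longleftrightarrow> inj_on g F \<and> g ` F \<inter> dom L = {} \<and> dom LF = dom L \<union> g ` F \<and>
     (\<forall>s\<in>dom L. LF s = L s) \<and> (\<forall>f\<in>F. LF (g f) = Some (arity f))"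

definition expand_class ::
  "'f lang \<Rightarrow> ('f, 'u) alg set \<Rightarrow> ('f, 'u) pfun set \<Rightarrow> (('f, 'u) pfun \<Rightarrow> 'f) \<Rightarrow> 'f lang
   \<Rightarrow> ('f, 'u) alg set" where
  "expand_class L K F g LF = {A. algebra LF A \<and> reduct L A \<in> K \<and>
     (\<forall>f\<in>F. \<forall>as\<in>tuples A (arity f). component f (reduct L A) as = Some (interp A (g f) as))}"

definition pp_expansion ::
  "'f lang \<Rightarrow> ('f, 'u) alg set \<Rightarrow> 'f lang \<Rightarrow> ('f, 'u) alg set \<Rightarrow> bool" where
  "pp_expansion L K LM M \<longleftrightarrow> (\<exists>F g. F \<subseteq> ext_pp L K \<and> expansion L F g LM \<and>
     M = Sub LM (expand_class L K F g LM))"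

definition equational_pp_expansion ::
  "'f lang \<Rightarrow> ('f, 'u) alg set \<Rightarrow> 'f lang \<Rightarrow> ('f, 'u) alg set \<Rightarrow> bool" where
  "equational_pp_expansion L K LM M \<longleftrightarrow> (\<exists>F g. F \<subseteq> ext_eq L K \<and> expansion L F g LM \<and>
     M = Sub LM (expand_class L K F g LM))"

definition Beth_companion ::
  "'f lang \<Rightarrow> ('f, 'u) alg set \<Rightarrow> 'f lang \<Rightarrow> ('f, 'u) alg set \<Rightarrow> bool" where
  "Beth_companion L K LM M \<longleftrightarrow> pp_expansion L K LM M \<and>
     (\<forall>f. implicit_operation L K f \<longrightarrow>
        (\<exists>T. (\<forall>t\<in>T. wf_trm LM {..<arity f} t) \<and>
             (\<forall>A\<in>M. \<forall>as\<in>dom (component f (reduct L A)). \<exists>t\<in>T.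
                component f (reduct L A) as = Some (eval A (asg as) t))))"

definition equational_Beth_companion ::
  "'f lang \<Rightarrow> ('f, 'u) alg set \<Rightarrow> 'f lang \<Rightarrow> ('f, 'u) alg set \<Rightarrow> bool" where
  "equational_Beth_companion L K LM M \<longleftrightarrow>
     Beth_companion L K LM M \<and> equational_pp_expansion L K LM M"

section \<open>Abelian lattice-ordered groups\<close>

text \<open>The symbols \<open>Extra s\<close> do not belong to the language of Abelian lattice-ordered groups; they
  are the supply of new symbols for its expansions.\<close>

datatype 's lg_sym = Plus | Minus | Meet | Join | Zero | Extra 's

fun lg_lang :: "'s lg_sym lang" where
  "lg_lang Plus = Some 2"
| "lg_lang Minus = Some 1"
| "lg_lang Meet = Some 2"
| "lg_lang Join = Some 2"
| "lg_lang Zero = Some 0"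
| "lg_lang (Extra s) = None"

definition lplus :: "('s lg_sym, 'u) alg \<Rightarrow> 'u \<Rightarrow> 'u \<Rightarrow> 'u" where
  "lplus A x y = interp A Plus [x, y]"

definition lminus :: "('s lg_sym, 'u) alg \<Rightarrow> 'u \<Rightarrow> 'u" where
  "lminus A x = interp A Minus [x]"

definition lmeet :: "('s lg_sym, 'u) alg \<Rightarrow> 'u \<Rightarrow> 'u \<Rightarrow> 'u" where
  "lmeet A x y = interp A Meet [x, y]"

definition ljoin :: "('s lg_sym, 'u) alg \<Rightarrow> 'u \<Rightarrow> 'u \<Rightarrow> 'u" where
  "ljoin A x y = interp A Join [x, y]"

definition lzero :: "('s lg_sym, 'u) alg \<Rightarrow> 'u" where
  "lzero A = interp A Zero []"

definition lle :: "('s lg_sym, 'u) alg \<Rightarrow> 'u \<Rightarrow> 'u \<Rightarrow> bool" where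
  "lle A x y \<longleftrightarrow> lmeet A x y = x"

definition lAG :: "('s lg_sym, 'u) alg set" where
  "lAG = {A \<in> small_algebras lg_lang.
     (\<forall>x\<in>carrier A. \<forall>y\<in>carrier A. \<forall>z\<in>carrier A.
        lplus A (lplus A x y) z = lplus A x (lplus A y z) \<and>
        lplus A x y = lplus A y x \<and>
        lplus A x (lzero A) = x \<and>
        lplus A x (lminus A x) = lzero A \<and>
        lmeet A (lmeet A x y) z = lmeet A x (lmeet A y z) \<and>
        lmeet A x y = lmeet A y x \<and>
        ljoin A (ljoin A x y) z = ljoin A x (ljoin A y z) \<and>
        ljoin A x y = ljoin A y x \<and>
        lmeet A x (ljoin A x y) = x \<and>
        ljoin A x (lmeet A x y) = x \<and>
        (lle A x y \<longrightarrow> lle A (lplus A x z) (lplus A y z)))}"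

definition nmult :: "('s lg_sym, 'u) alg \<Rightarrow> nat \<Rightarrow> 'u \<Rightarrow> 'u" where
  "nmult A n b = (lplus A b ^^ n) (lzero A)"

definition div_op :: "nat \<Rightarrow> ('s lg_sym, 'u) pfun" where
  "div_op n =
    \<lparr>arity = 1,
     component = (\<lambda>A as. if A \<in> lAG \<and> as \<in> tuples A 1 \<and> (\<exists>b\<in>carrier A. nmult A n b = as ! 0)
                    then Some (THE b. b \<in> carrier A \<and> nmult A n b = as ! 0) else None)\<rparr>"

definition div_ops :: "('s lg_sym, 'u) pfun set" where
  "div_ops = {div_op n | n. n \<ge> 1}"

definition lDAG ::
  "(('s lg_sym, 'u) pfun \<Rightarrow> 's lg_sym) \<Rightarrow> 's lg_sym lang \<Rightarrow> ('s lg_sym, 'u) alg set" where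
  "lDAG g LF = Sub LF (expand_class lg_lang lAG div_ops g LF)"

end

theory Submission
  imports Defs
begin

text \<open>Division by \<open>n\<close> is functional because Abelian \<open>\<ell>\<close>-groups are torsion-free, and it is preserved by
  homomorphisms because it is given by an equation. It is extendable because multiplication by \<open>n\<close> is
  an embedding of an Abelian \<open>\<ell>\<close>-group \<open>A\<close> into itself: after a renaming of elements the
  embedding becomes an inclusion of \<open>A\<close> into a copy of \<open>A\<close> in which all elements of the original
  are divisible by \<open>n\<close> (\<open>self_embedding_as_inclusion\<close>, \<open>div_op_extendable\<close>). An algebra in which all
  the divisions are total is described by the equations of Abelian \<open>\<ell>\<close>-groups and the equations
  \<open>n (x / n) = x\<close>. These pass to subalgebras, so \<open>lDAG\<close> is the class of all models of these
  equations (\<open>lDAG_equational\<close>) and hence a variety.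

  For the Beth property, let \<open>f\<close> be an implicit operation, \<open>A \<in> lDAG\<close>, and \<open>b = f(as)\<close> in \<open>A\<close>. The claim is
  that \<open>b\<close> lies in the subalgebra \<open>C\<close> generated by \<open>as\<close>, which is an \<open>\<ell>\<close>-subgroup closed under
  division. Otherwise there are homomorphisms \<open>h, k\<close> from \<open>A\<close> to a totally ordered
  Abelian group \<open>D\<close> that agree on \<open>C\<close> with \<open>h b \<noteq> k b\<close>; this contradicts the preservation of \<open>f\<close>, for
  \<open>h b = f(h as) = f(k as) = k b\<close>. In other words, an epimorphic extension of a divisible Abelian
  \<open>\<ell>\<close>-group is trivial (\<open>divisible_sublattice_group_dominion\<close>).

  The homomorphisms are found in two steps. First, an element outside the sublattice \<open>C\<close> is
  detected by two prime ideals \<open>P, Q\<close> of \<open>A\<close>: no \<open>c \<in> C\<close> satisfies both \<open>b \<le> c\<close> modulo \<open>P\<close> and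
  \<open>c \<le> b\<close> modulo \<open>Q\<close> (\<open>prime_ideals_separating\<close>). Second, the quotients by \<open>P\<close> and \<open>Q\<close> are chains, and
  they are amalgamated over \<open>C\<close>: the cone on \<open>A \<times> A\<close> generated by the two orders and by the
  pairs \<open>(c, -c)\<close> contains no positive multiple of \<open>(-b, b)\<close>, because \<open>C\<close> is divisible, and so extends to
  a total preorder in which \<open>(-b, b)\<close> is not positive (\<open>total_submonoid_avoiding\<close>). The quotient of
  \<open>A \<times> A\<close> by this preorder is \<open>D\<close>, and the two coordinate embeddings induce \<open>h\<close> and \<open>k\<close>. As \<open>A\<close> is
  infinite whenever it has a nonzero element, \<open>D\<close> is no larger than \<open>A\<close>.\<close>

section \<open>Abelian groups on a carrier set\<close>

locale abelian_group_on =
  fixes S :: "'a set"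
    and add :: "'a \<Rightarrow> 'a \<Rightarrow> 'a" (infixl "\<oplus>" 65)
    and neg :: "'a \<Rightarrow> 'a" ("\<ominus> _" [81] 80)
    and zero :: "'a" ("\<zero>")
  assumes add_closed [simp, intro]: "x \<in> S \<Longrightarrow> y \<in> S \<Longrightarrow> x \<oplus> y \<in> S"
    and neg_closed [simp, intro]: "x \<in> S \<Longrightarrow> \<ominus> x \<in> S"
    and zero_closed [simp, intro]: "\<zero> \<in> S"
    and add_assoc: "x \<in> S \<Longrightarrow> y \<in> S \<Longrightarrow> z \<in> S \<Longrightarrow> (x \<oplus> y) \<oplus> z = x \<oplus> (y \<oplus> z)"
    and add_commute: "x \<in> S \<Longrightarrow> y \<in> S \<Longrightarrow> x \<oplus> y = y \<oplus> x"
    and add_zero [simp]: "x \<in> S \<Longrightarrow> x \<oplus> \<zero> = x"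
    and add_neg [simp]: "x \<in> S \<Longrightarrow> x \<oplus> \<ominus> x = \<zero>"
begin

lemma zero_add [simp]: "x \<in> S \<Longrightarrow> \<zero> \<oplus> x = x"
  by (metis add_commute add_zero zero_closed)

lemma neg_add [simp]: "x \<in> S \<Longrightarrow> \<ominus> x \<oplus> x = \<zero>"
  by (metis add_commute add_neg neg_closed)

lemma add_left_commute: "x \<in> S \<Longrightarrow> y \<in> S \<Longrightarrow> z \<in> S \<Longrightarrow> x \<oplus> (y \<oplus> z) = y \<oplus> (x \<oplus> z)"
  by (metis add_assoc add_commute)

lemmas add_ac = add_assoc add_commute add_left_commute

lemma neg_add_cancel_left [simp]: "x \<in> S \<Longrightarrow> y \<in> S \<Longrightarrow> \<ominus> x \<oplus> (x \<oplus> y) = y"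
  by (simp flip: add_assoc)

lemma add_neg_cancel_right [simp]: "x \<in> S \<Longrightarrow> y \<in> S \<Longrightarrow> x \<oplus> y \<oplus> \<ominus> y = x"
  by (simp add: add_assoc)

lemma neg_add_cancel_right [simp]: "x \<in> S \<Longrightarrow> y \<in> S \<Longrightarrow> x \<oplus> \<ominus> y \<oplus> y = x"
  by (simp add: add_assoc)

lemma neg_unique: "x \<in> S \<Longrightarrow> y \<in> S \<Longrightarrow> x \<oplus> y = \<zero> \<Longrightarrow> \<ominus> x = y"
  by (metis neg_add_cancel_left add_zero neg_closed)

lemma neg_neg [simp]: "x \<in> S \<Longrightarrow> \<ominus> (\<ominus> x) = x"
  by (simp add: neg_unique)

lemma neg_zero [simp]: "\<ominus> \<zero> = \<zero>"
  by (simp add: neg_unique)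

lemma neg_distrib: "x \<in> S \<Longrightarrow> y \<in> S \<Longrightarrow> \<ominus> (x \<oplus> y) = \<ominus> x \<oplus> \<ominus> y"
  by (rule neg_unique) (simp_all add: add_left_commute[of _ "\<ominus> x"] add_assoc)

lemma diff_add_diff:
  assumes "x \<in> S" "y \<in> S" "z \<in> S"
  shows "(x \<oplus> \<ominus> y) \<oplus> (y \<oplus> \<ominus> z) = x \<oplus> \<ominus> z"
  using assms by (simp add: add_assoc)

lemma add_diff_add:
  assumes "x \<in> S" "y \<in> S" "z \<in> S" "u \<in> S"
  shows "(x \<oplus> y) \<oplus> \<ominus> (z \<oplus> u) = (x \<oplus> \<ominus> z) \<oplus> (y \<oplus> \<ominus> u)"
  using assms by (simp add: neg_distrib add_ac)

lemma neg_diff: "x \<in> S \<Longrightarrow> y \<in> S \<Longrightarrow> \<ominus> (x \<oplus> \<ominus> y) = y \<oplus> \<ominus> x"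
  by (simp add: neg_distrib add_commute)

definition mult :: "nat \<Rightarrow> 'a \<Rightarrow> 'a" where
  "mult n x = ((\<oplus>) x ^^ n) \<zero>"

lemma mult_0 [simp]: "mult 0 x = \<zero>"
  and mult_Suc [simp]: "mult (Suc n) x = x \<oplus> mult n x"
  by (simp_all add: mult_def)

lemma mult_closed [simp, intro]: "x \<in> S \<Longrightarrow> mult n x \<in> S"
  by (induction n) auto

lemma mult_zero [simp]: "mult n \<zero> = \<zero>"
  by (induction n) auto

lemma mult_add: "x \<in> S \<Longrightarrow> y \<in> S \<Longrightarrow> mult n (x \<oplus> y) = mult n x \<oplus> mult n y"
  by (induction n) (auto simp: add_ac)

lemma mult_neg: "x \<in> S \<Longrightarrow> mult n (\<ominus> x) = \<ominus> mult n x"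
  by (induction n) (auto simp: neg_distrib)

lemma mult_plus: "x \<in> S \<Longrightarrow> mult (m + n) x = mult m x \<oplus> mult n x"
  by (induction m) (auto simp: add_ac)

lemma mult_mult: "x \<in> S \<Longrightarrow> mult m (mult n x) = mult (m * n) x"
  by (induction m) (auto simp: mult_plus)

definition submonoid :: "'a set \<Rightarrow> bool" where
  "submonoid M \<longleftrightarrow> M \<subseteq> S \<and> \<zero> \<in> M \<and> (\<forall>x\<in>M. \<forall>y\<in>M. x \<oplus> y \<in> M)"

lemma submonoid_mult: "submonoid M \<Longrightarrow> x \<in> M \<Longrightarrow> mult n x \<in> M"
  by (induction n) (auto simp: submonoid_def)

text \<open>A partial order on an Abelian group whose positive cone contains no positive multiple of
  \<open>w\<close> extends to a total preorder in which \<open>w\<close> is not positive. A cone maximal with this property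
  is total: if neither \<open>x\<close> nor \<open>\<ominus> x\<close> could be added to it, then some \<open>i w\<close> and \<open>j w\<close> would be of the form
  \<open>m + k x\<close> and \<open>m' - l x\<close>, and eliminating \<open>x\<close> would put the multiple \<open>(l i + k j) w\<close> into the cone.\<close>

lemma total_submonoid_avoiding:
  assumes M0: "submonoid M0" and w: "w \<in> S" and av: "\<And>n. n \<ge> 1 \<Longrightarrow> mult n w \<notin> M0"
  obtains M where "submonoid M" "M0 \<subseteq> M" "w \<notin> M" "\<And>x. x \<in> S \<Longrightarrow> x \<in> M \<or> \<ominus> x \<in> M"
proof -
  let ?\<A> = "{M. submonoid M \<and> M0 \<subseteq> M \<and> (\<forall>n\<ge>1. mult n w \<notin> M)}"
  have "\<exists>M\<in>?\<A>. \<forall>X\<in>?\<A>. M \<subseteq> X \<longrightarrow> X = M"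
  proof (rule subset_Zorn_nonempty)
    show "?\<A> \<noteq> {}" using M0 av by blast
  next
    fix \<C> assume ne: "\<C> \<noteq> {}" and ch: "subset.chain ?\<A> \<C>"
    have sub: "submonoid N" "M0 \<subseteq> N" "\<forall>n\<ge>1. mult n w \<notin> N" if "N \<in> \<C>" for N
      using ch that by (auto simp: subset.chain_def)
    have "x \<oplus> y \<in> \<Union>\<C>" if "x \<in> N" "N \<in> \<C>" "y \<in> N'" "N' \<in> \<C>" for x y N N'
    proof -
      have "N \<subseteq> N' \<or> N' \<subseteq> N" using ch that unfolding subset_chain_def by blast
      then show ?thesis using that sub(1)[of N] sub(1)[of N'] unfolding submonoid_def by (meson UnionI subsetD)
    qed
    then have "submonoid (\<Union>\<C>)"
      using ne sub(1) unfolding submonoid_def by (intro conjI ballI) blast+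
    then show "\<Union>\<C> \<in> ?\<A>" using ne sub(2,3) by auto
  qed
  then obtain M where M: "submonoid M" "M0 \<subseteq> M" "\<And>n. n \<ge> 1 \<Longrightarrow> mult n w \<notin> M"
    and max: "\<And>X. submonoid X \<Longrightarrow> M0 \<subseteq> X \<Longrightarrow> \<forall>n\<ge>1. mult n w \<notin> X \<Longrightarrow> M \<subseteq> X \<Longrightarrow> X = M"
    by auto
  have MS: "M \<subseteq> S" using M(1) by (simp add: submonoid_def)
  have hit: "\<exists>n\<ge>1. \<exists>m\<in>M. \<exists>k. mult n w = m \<oplus> mult k x" if x: "x \<in> S" "x \<notin> M" for x
  proof -
    let ?X = "{m \<oplus> mult k x | m k. m \<in> M}"
    have sm: "submonoid ?X"
      unfolding submonoid_def
    proof (intro conjI ballI)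
      show "?X \<subseteq> S" using MS x by auto
      show "\<zero> \<in> ?X" using M(1) by (auto simp: submonoid_def intro!: exI[of _ \<zero>] exI[of _ 0])
      fix u v assume "u \<in> ?X" "v \<in> ?X"
      then obtain m k m' k' where mk: "u = m \<oplus> mult k x" "m \<in> M" "v = m' \<oplus> mult k' x" "m' \<in> M"
        by blast
      then have "u \<oplus> v = (m \<oplus> m') \<oplus> mult (k + k') x"
        using MS x by (auto simp: mult_plus add_ac subset_iff)
      then show "u \<oplus> v \<in> ?X" using mk M(1) by (auto simp: submonoid_def)
    qed
    have sub: "M \<subseteq> ?X"
    proof
      fix m assume "m \<in> M"
      then have "m = m \<oplus> mult 0 x" using MS by auto
      then show "m \<in> ?X" using \<open>m \<in> M\<close> by blast
    qed
    have "x = \<zero> \<oplus> mult 1 x" using x by simp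
    moreover have "\<zero> \<in> M" using M(1) by (simp add: submonoid_def)
    ultimately have "x \<in> ?X" by blast
    then have "?X \<noteq> M" using x by auto
    then have "\<exists>n\<ge>1. mult n w \<in> ?X" using max[OF sm _ _ sub] M(2) sub by blast
    then show ?thesis by blast
  qed
  have "x \<in> M \<or> \<ominus> x \<in> M" if x: "x \<in> S" for x
  proof (rule ccontr)
    assume "\<not> (x \<in> M \<or> \<ominus> x \<in> M)"
    then obtain i m k j m' l where
      i: "i \<ge> 1" "m \<in> M" "mult i w = m \<oplus> mult k x" and
      j: "j \<ge> 1" "m' \<in> M" "mult j w = m' \<oplus> mult l (\<ominus> x)"
      using hit[of x] hit[of "\<ominus> x"] x by blast
    have k: "k \<noteq> 0" using i M(3)[of i] MS by (auto simp: subset_iff intro: ccontr)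
    have mS: "m \<in> S" "m' \<in> S" using i j MS by auto
    have "mult (l * i + k * j) w = mult l (m \<oplus> mult k x) \<oplus> mult k (m' \<oplus> mult l (\<ominus> x))"
      using w by (simp add: mult_plus mult_mult flip: i(3) j(3))
    also have "\<dots> = (mult l m \<oplus> mult (l * k) x) \<oplus> (mult k m' \<oplus> \<ominus> mult (l * k) x)"
      using mS x by (simp add: mult_add mult_mult mult_neg mult.commute)
    also have "\<dots> = (mult l m \<oplus> mult k m') \<oplus> (mult (l * k) x \<oplus> \<ominus> mult (l * k) x)"
      using mS x by (simp only: add_ac mult_closed neg_closed add_closed)
    also have "\<dots> = mult l m \<oplus> mult k m'" using mS x by simp
    also have "\<dots> \<in> M" using submonoid_mult[OF M(1)] i j M(1) by (simp add: submonoid_def)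
    finally have "mult (l * i + k * j) w \<in> M" .
    moreover have "l * i + k * j \<ge> 1" using k j(1) by (cases k; cases j) auto
    ultimately show False using M(3) by blast
  qed
  then show thesis using that[of M] M(1,2) M(3)[of 1] w by auto
qed

end

section \<open>Abelian lattice-ordered groups on a carrier set\<close>

locale lattice_group_on = abelian_group_on +
  fixes meet :: "'a \<Rightarrow> 'a \<Rightarrow> 'a" (infixl "\<sqinter>" 70)
    and join :: "'a \<Rightarrow> 'a \<Rightarrow> 'a" (infixl "\<squnion>" 65)
  assumes meet_closed [simp, intro]: "x \<in> S \<Longrightarrow> y \<in> S \<Longrightarrow> x \<sqinter> y \<in> S"
    and join_closed [simp, intro]: "x \<in> S \<Longrightarrow> y \<in> S \<Longrightarrow> x \<squnion> y \<in> S"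
    and meet_assoc: "x \<in> S \<Longrightarrow> y \<in> S \<Longrightarrow> z \<in> S \<Longrightarrow> (x \<sqinter> y) \<sqinter> z = x \<sqinter> (y \<sqinter> z)"
    and meet_commute: "x \<in> S \<Longrightarrow> y \<in> S \<Longrightarrow> x \<sqinter> y = y \<sqinter> x"
    and join_assoc: "x \<in> S \<Longrightarrow> y \<in> S \<Longrightarrow> z \<in> S \<Longrightarrow> (x \<squnion> y) \<squnion> z = x \<squnion> (y \<squnion> z)"
    and join_commute: "x \<in> S \<Longrightarrow> y \<in> S \<Longrightarrow> x \<squnion> y = y \<squnion> x"
    and meet_join: "x \<in> S \<Longrightarrow> y \<in> S \<Longrightarrow> x \<sqinter> (x \<squnion> y) = x"
    and join_meet: "x \<in> S \<Longrightarrow> y \<in> S \<Longrightarrow> x \<squnion> (x \<sqinter> y) = x"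
    and meet_add_mono: "x \<in> S \<Longrightarrow> y \<in> S \<Longrightarrow> z \<in> S \<Longrightarrow> x \<sqinter> y = x \<Longrightarrow> (x \<oplus> z) \<sqinter> (y \<oplus> z) = x \<oplus> z"
begin

definition le :: "'a \<Rightarrow> 'a \<Rightarrow> bool" (infix "\<sqsubseteq>" 50) where
  "x \<sqsubseteq> y \<longleftrightarrow> x \<sqinter> y = x"

lemma le_refl [simp]: "x \<in> S \<Longrightarrow> x \<sqsubseteq> x"
  by (metis le_def join_meet meet_join meet_closed)

lemma le_antisym: "x \<in> S \<Longrightarrow> y \<in> S \<Longrightarrow> x \<sqsubseteq> y \<Longrightarrow> y \<sqsubseteq> x \<Longrightarrow> x = y"
  by (metis le_def meet_commute)

lemma le_trans: "x \<in> S \<Longrightarrow> y \<in> S \<Longrightarrow> z \<in> S \<Longrightarrow> x \<sqsubseteq> y \<Longrightarrow> y \<sqsubseteq> z \<Longrightarrow> x \<sqsubseteq> z"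
  by (metis le_def meet_assoc)

lemma meet_le1 [simp]: "x \<in> S \<Longrightarrow> y \<in> S \<Longrightarrow> x \<sqinter> y \<sqsubseteq> x"
  by (metis le_def le_refl meet_assoc meet_commute meet_closed)

lemma meet_le2 [simp]: "x \<in> S \<Longrightarrow> y \<in> S \<Longrightarrow> x \<sqinter> y \<sqsubseteq> y"
  by (metis meet_commute meet_le1)

lemma meet_greatest: "x \<in> S \<Longrightarrow> y \<in> S \<Longrightarrow> z \<in> S \<Longrightarrow> z \<sqsubseteq> x \<Longrightarrow> z \<sqsubseteq> y \<Longrightarrow> z \<sqsubseteq> x \<sqinter> y"
  by (metis le_def meet_assoc)

lemma le_iff_join: "x \<in> S \<Longrightarrow> y \<in> S \<Longrightarrow> x \<sqsubseteq> y \<longleftrightarrow> x \<squnion> y = y"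
  by (metis le_def join_commute join_meet meet_commute meet_join)

lemma join_ge1 [simp]: "x \<in> S \<Longrightarrow> y \<in> S \<Longrightarrow> x \<sqsubseteq> x \<squnion> y"
  by (simp add: le_def meet_join)

lemma join_ge2 [simp]: "x \<in> S \<Longrightarrow> y \<in> S \<Longrightarrow> y \<sqsubseteq> x \<squnion> y"
  by (metis join_commute join_ge1)

lemma join_least: "x \<in> S \<Longrightarrow> y \<in> S \<Longrightarrow> z \<in> S \<Longrightarrow> x \<sqsubseteq> z \<Longrightarrow> y \<sqsubseteq> z \<Longrightarrow> x \<squnion> y \<sqsubseteq> z"
  by (metis le_iff_join join_assoc join_closed)

lemma add_right_mono: "x \<in> S \<Longrightarrow> y \<in> S \<Longrightarrow> z \<in> S \<Longrightarrow> x \<sqsubseteq> y \<Longrightarrow> x \<oplus> z \<sqsubseteq> y \<oplus> z"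
  by (simp add: le_def meet_add_mono)

lemma add_le_right_iff [simp]: "x \<in> S \<Longrightarrow> y \<in> S \<Longrightarrow> z \<in> S \<Longrightarrow> x \<oplus> z \<sqsubseteq> y \<oplus> z \<longleftrightarrow> x \<sqsubseteq> y"
  by (metis add_right_mono add_neg_cancel_right add_closed neg_closed)

lemma add_le_left_iff [simp]: "x \<in> S \<Longrightarrow> y \<in> S \<Longrightarrow> z \<in> S \<Longrightarrow> z \<oplus> x \<sqsubseteq> z \<oplus> y \<longleftrightarrow> x \<sqsubseteq> y"
  by (simp add: add_commute[of z])

lemma add_mono:
  assumes "x \<in> S" "y \<in> S" "z \<in> S" "u \<in> S" "x \<sqsubseteq> y" "z \<sqsubseteq> u"
  shows "x \<oplus> z \<sqsubseteq> y \<oplus> u"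
  by (rule le_trans[of _ "y \<oplus> z"]) (use assms in auto)

lemma add_nonneg: "x \<in> S \<Longrightarrow> y \<in> S \<Longrightarrow> \<zero> \<sqsubseteq> x \<Longrightarrow> \<zero> \<sqsubseteq> y \<Longrightarrow> \<zero> \<sqsubseteq> x \<oplus> y"
  using add_mono[of \<zero> x \<zero> y] by simp

lemma mult_nonneg: "x \<in> S \<Longrightarrow> \<zero> \<sqsubseteq> x \<Longrightarrow> \<zero> \<sqsubseteq> mult n x"
  by (induction n) (auto intro: add_nonneg)

lemma diff_le_iff: "x \<in> S \<Longrightarrow> y \<in> S \<Longrightarrow> z \<in> S \<Longrightarrow> x \<oplus> \<ominus> y \<sqsubseteq> z \<longleftrightarrow> x \<sqsubseteq> z \<oplus> y"
  by (metis add_le_right_iff neg_add_cancel_right add_closed neg_closed)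

lemma nonneg_diff_iff: "x \<in> S \<Longrightarrow> y \<in> S \<Longrightarrow> \<zero> \<sqsubseteq> y \<oplus> \<ominus> x \<longleftrightarrow> x \<sqsubseteq> y"
  by (metis add_le_right_iff neg_add_cancel_right zero_add add_closed neg_closed zero_closed)

lemma neg_le_iff: "x \<in> S \<Longrightarrow> y \<in> S \<Longrightarrow> \<ominus> x \<sqsubseteq> \<ominus> y \<longleftrightarrow> y \<sqsubseteq> x"
  by (metis nonneg_diff_iff add_commute neg_closed neg_neg)

lemma nonneg_neg_iff: "x \<in> S \<Longrightarrow> \<zero> \<sqsubseteq> \<ominus> x \<longleftrightarrow> x \<sqsubseteq> \<zero>"
  using neg_le_iff[of \<zero> x] by simp

lemma meet_add:
  assumes "x \<in> S" "y \<in> S" "z \<in> S"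
  shows "(x \<sqinter> y) \<oplus> z = (x \<oplus> z) \<sqinter> (y \<oplus> z)" (is "?l = ?r")
proof (rule le_antisym)
  show "?l \<sqsubseteq> ?r" using assms by (intro meet_greatest) auto
  have "?r \<oplus> \<ominus> z \<sqsubseteq> x \<sqinter> y"
    using assms by (intro meet_greatest) (auto simp: diff_le_iff)
  then show "?r \<sqsubseteq> ?l" using assms by (simp add: diff_le_iff)
qed (use assms in auto)

lemma join_eq_neg_meet:
  assumes "x \<in> S" "y \<in> S"
  shows "x \<squnion> y = \<ominus> (\<ominus> x \<sqinter> \<ominus> y)"
proof (rule le_antisym)
  have "\<ominus> x \<sqinter> \<ominus> y \<sqsubseteq> \<ominus> x" "\<ominus> x \<sqinter> \<ominus> y \<sqsubseteq> \<ominus> y" using assms by auto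
  then have "x \<sqsubseteq> \<ominus> (\<ominus> x \<sqinter> \<ominus> y)" "y \<sqsubseteq> \<ominus> (\<ominus> x \<sqinter> \<ominus> y)"
    using assms neg_le_iff[of "\<ominus> x" "\<ominus> x \<sqinter> \<ominus> y"] neg_le_iff[of "\<ominus> y" "\<ominus> x \<sqinter> \<ominus> y"] by auto
  then show "x \<squnion> y \<sqsubseteq> \<ominus> (\<ominus> x \<sqinter> \<ominus> y)" using assms by (intro join_least) auto
  have "\<ominus> (x \<squnion> y) \<sqsubseteq> \<ominus> x \<sqinter> \<ominus> y" using assms by (intro meet_greatest) (auto simp: neg_le_iff)
  then show "\<ominus> (\<ominus> x \<sqinter> \<ominus> y) \<sqsubseteq> x \<squnion> y"
    using assms neg_le_iff[of "\<ominus> x \<sqinter> \<ominus> y" "\<ominus> (x \<squnion> y)"] by simp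
qed (use assms in auto)

subsection \<open>Disjoint elements and multiples\<close>

lemma disjoint_nonneg: "x \<in> S \<Longrightarrow> y \<in> S \<Longrightarrow> x \<sqinter> y = \<zero> \<Longrightarrow> \<zero> \<sqsubseteq> x \<and> \<zero> \<sqsubseteq> y"
  by (metis meet_le1 meet_le2)

text \<open>For \<open>t = x \<sqinter> (y \<oplus> z)\<close> the element \<open>t - z\<close> lies below both \<open>x\<close> and \<open>y\<close>, so \<open>t\<close> lies below \<open>x\<close> and \<open>z\<close>.\<close>

lemma disjoint_add:
  assumes "x \<in> S" "y \<in> S" "z \<in> S" "x \<sqinter> y = \<zero>" "x \<sqinter> z = \<zero>"
  shows "x \<sqinter> (y \<oplus> z) = \<zero>"
proof (rule le_antisym)
  have nn: "\<zero> \<sqsubseteq> x" "\<zero> \<sqsubseteq> y" "\<zero> \<sqsubseteq> z" using assms disjoint_nonneg by blast+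
  then show "\<zero> \<sqsubseteq> x \<sqinter> (y \<oplus> z)" using assms by (intro meet_greatest add_nonneg) auto
  let ?t = "x \<sqinter> (y \<oplus> z)"
  have t: "?t \<in> S" "?t \<sqsubseteq> x" "?t \<sqsubseteq> y \<oplus> z" using assms by auto
  have "x \<sqsubseteq> x \<oplus> z" using add_mono[of x x \<zero> z] assms nn by simp
  then have "?t \<sqsubseteq> x \<oplus> z" using le_trans[of ?t x] t assms by auto
  then have "?t \<oplus> \<ominus> z \<sqsubseteq> x \<sqinter> y"
    using assms t by (intro meet_greatest) (simp_all add: diff_le_iff)
  then have "?t \<sqsubseteq> z" using assms t by (simp add: diff_le_iff)
  then have "?t \<sqsubseteq> x \<sqinter> z" using t assms by (intro meet_greatest) auto
  then show "?t \<sqsubseteq> \<zero>" using assms by simp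
qed (use assms in auto)

lemma disjoint_mult:
  assumes "x \<in> S" "y \<in> S" "x \<sqinter> y = \<zero>"
  shows "mult m x \<sqinter> mult n y = \<zero>"
proof -
  have *: "u \<sqinter> mult n v = \<zero>" if "u \<in> S" "v \<in> S" "u \<sqinter> v = \<zero>" for u v n
  proof (induction n)
    case 0
    show ?case using that disjoint_nonneg[of u v] by (simp add: le_def meet_commute[of u])
  next
    case (Suc n)
    then show ?case using that by (simp add: disjoint_add)
  qed
  have "mult n y \<sqinter> mult m x = \<zero>"
    using assms *[of x y n] by (intro *) (auto simp: meet_commute)
  then show ?thesis using assms by (simp add: meet_commute)
qed

text \<open>Writing \<open>x = u - v\<close> with \<open>u \<sqinter> v = \<zero>\<close>, the negative part \<open>x \<sqinter> \<zero>\<close> is \<open>- v\<close>, and \<open>n u\<close> and \<open>n v\<close>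
  are again disjoint.\<close>

lemma mult_meet_zero:
  assumes x: "x \<in> S"
  shows "mult n x \<sqinter> \<zero> = mult n (x \<sqinter> \<zero>)"
proof -
  define v where "v = \<ominus> (x \<sqinter> \<zero>)"
  define u where "u = x \<oplus> v"
  have S: "u \<in> S" "v \<in> S" using x by (auto simp: u_def v_def)
  have "u \<sqinter> v = (x \<sqinter> \<zero>) \<oplus> v" using x S by (simp add: meet_add u_def)
  also have "\<dots> = \<zero>" using x by (simp add: v_def)
  finally have uv: "u \<sqinter> v = \<zero>" .
  have "(mult n x \<sqinter> \<zero>) \<oplus> mult n v = mult n u \<sqinter> mult n v"
    using x S by (simp add: meet_add u_def mult_add)
  also have "\<dots> = \<zero>" using disjoint_mult[of u v] S uv by simp
  finally have "mult n x \<sqinter> \<zero> = \<ominus> mult n v"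
    using S x by (metis add_commute neg_unique meet_closed mult_closed zero_closed)
  also have "\<dots> = mult n (x \<sqinter> \<zero>)" using x by (simp add: v_def mult_neg)
  finally show ?thesis .
qed

lemma mult_meet:
  assumes "x \<in> S" "y \<in> S"
  shows "mult n (x \<sqinter> y) = mult n x \<sqinter> mult n y"
proof -
  have *: "((x \<oplus> \<ominus> y) \<sqinter> \<zero>) \<oplus> y = x \<sqinter> y" if "x \<in> S" "y \<in> S" for x y
    using that by (simp add: meet_add)
  have "mult n (x \<sqinter> y) = mult n ((x \<oplus> \<ominus> y) \<sqinter> \<zero>) \<oplus> mult n y"
    using assms by (simp flip: mult_add *[of x y])
  also have "\<dots> = ((mult n x \<oplus> \<ominus> mult n y) \<sqinter> \<zero>) \<oplus> mult n y"
    using assms by (simp add: mult_add mult_neg flip: mult_meet_zero)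
  finally show ?thesis using assms by (simp add: *)
qed

text \<open>If \<open>n x\<close> is positive, then \<open>n t = \<zero>\<close> for the negative part \<open>t = x \<sqinter> \<zero>\<close>; so \<open>t\<close> is a multiple of \<open>- t\<close>
  and hence both negative and positive.\<close>

lemma nonneg_of_mult_nonneg:
  assumes x: "x \<in> S" and n: "n \<ge> 1" and nn: "\<zero> \<sqsubseteq> mult n x"
  shows "\<zero> \<sqsubseteq> x"
proof -
  obtain k where k: "n = Suc k" using n by (cases n) auto
  define t where "t = x \<sqinter> \<zero>"
  have t: "t \<in> S" "t \<sqsubseteq> \<zero>" using x by (auto simp: t_def)
  have "mult n t = \<zero>"
    using x nn by (simp add: t_def le_def meet_commute flip: mult_meet_zero)
  then have "\<ominus> t = mult k t" using t k by (simp add: neg_unique)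
  then have "mult k (\<ominus> t) = t" using t by (metis mult_neg neg_neg)
  moreover have "\<zero> \<sqsubseteq> mult k (\<ominus> t)" using t by (intro mult_nonneg) (auto simp: nonneg_neg_iff)
  ultimately have "t = \<zero>" using t by (auto intro: le_antisym)
  then show ?thesis using x by (simp add: t_def le_def meet_commute)
qed

lemma mult_inject:
  assumes "x \<in> S" "y \<in> S" "n \<ge> 1" "mult n x = mult n y"
  shows "x = y"
proof -
  have "\<zero> \<sqsubseteq> x \<oplus> \<ominus> y" "\<zero> \<sqsubseteq> y \<oplus> \<ominus> x"
    by (rule nonneg_of_mult_nonneg[of _ n]; use assms in \<open>simp add: mult_add mult_neg\<close>)+
  then show ?thesis using assms by (intro le_antisym) (auto simp: nonneg_diff_iff)
qed

text \<open>This makes room for \<open>S \<times> S\<close> in a universe that is larger than \<open>S\<close>.\<close>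

lemma infinite_if_nonzero:
  assumes x: "x \<in> S" "x \<noteq> \<zero>"
  shows "infinite S"
proof -
  have "inj (\<lambda>n. mult n x)"
  proof (rule linorder_injI)
    fix m n :: nat assume mn: "m < n"
    show "mult m x \<noteq> mult n x"
    proof
      assume eq: "mult m x = mult n x"
      have "mult n x = mult m x \<oplus> mult (n - m) x" using mn x by (simp flip: mult_plus)
      then have "mult (n - m) x = mult (n - m) \<zero>" using eq x
        by (metis neg_add neg_add_cancel_left mult_closed mult_zero)
      moreover have "n - m \<ge> 1" using mn by simp
      ultimately show False using mult_inject[of x \<zero> "n - m"] x by blast
    qed
  qed
  then have "infinite (range (\<lambda>n. mult n x))" by (rule range_inj_infinite)
  moreover have "range (\<lambda>n. mult n x) \<subseteq> S" using x by auto
  ultimately show ?thesis by (rule infinite_super[rotated])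
qed

subsection \<open>Prime ideals\<close>

text \<open>An \<open>\<ell>\<close>-ideal is represented by its set of positive elements.\<close>

definition positive_ideal :: "'a set \<Rightarrow> bool" where
  "positive_ideal P \<longleftrightarrow> P \<subseteq> S \<and> \<zero> \<in> P \<and> (\<forall>p\<in>P. \<zero> \<sqsubseteq> p) \<and> (\<forall>p\<in>P. \<forall>q\<in>P. p \<oplus> q \<in> P) \<and>
     (\<forall>p\<in>P. \<forall>x\<in>S. \<zero> \<sqsubseteq> x \<longrightarrow> x \<sqsubseteq> p \<longrightarrow> x \<in> P)"

definition prime_ideal :: "'a set \<Rightarrow> bool" where
  "prime_ideal P \<longleftrightarrow> positive_ideal P \<and> (\<forall>x\<in>S. \<forall>y\<in>S. x \<sqinter> y = \<zero> \<longrightarrow> x \<in> P \<or> y \<in> P)"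

text \<open>The positive cone of the quotient by \<open>P\<close>, pulled back so that no quotient has to be formed.\<close>

definition nonneg_mod :: "'a set \<Rightarrow> 'a set" where
  "nonneg_mod P = {x \<in> S. \<exists>p\<in>P. \<zero> \<sqsubseteq> x \<oplus> p}"

lemma positive_idealD:
  assumes "positive_ideal P"
  shows "p \<in> P \<Longrightarrow> p \<in> S" "\<zero> \<in> P" "p \<in> P \<Longrightarrow> \<zero> \<sqsubseteq> p" "p \<in> P \<Longrightarrow> q \<in> P \<Longrightarrow> p \<oplus> q \<in> P"
    "p \<in> P \<Longrightarrow> x \<in> S \<Longrightarrow> \<zero> \<sqsubseteq> x \<Longrightarrow> x \<sqsubseteq> p \<Longrightarrow> x \<in> P"
  using assms unfolding positive_ideal_def by blast+

lemma nonneg_modI: "p \<in> P \<Longrightarrow> x \<in> S \<Longrightarrow> \<zero> \<sqsubseteq> x \<oplus> p \<Longrightarrow> x \<in> nonneg_mod P"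
  by (auto simp: nonneg_mod_def)

lemma nonneg_in_nonneg_mod: "positive_ideal P \<Longrightarrow> x \<in> S \<Longrightarrow> \<zero> \<sqsubseteq> x \<Longrightarrow> x \<in> nonneg_mod P"
  by (rule nonneg_modI[of \<zero>]) (simp_all add: positive_idealD(2))

lemma submonoid_nonneg_mod:
  assumes P: "positive_ideal P"
  shows "submonoid (nonneg_mod P)"
  unfolding submonoid_def
proof (intro conjI ballI)
  show "\<zero> \<in> nonneg_mod P" using P by (intro nonneg_in_nonneg_mod) auto
  fix x y assume "x \<in> nonneg_mod P" "y \<in> nonneg_mod P"
  then obtain p q where *: "x \<in> S" "p \<in> P" "\<zero> \<sqsubseteq> x \<oplus> p" "y \<in> S" "q \<in> P" "\<zero> \<sqsubseteq> y \<oplus> q"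
    by (auto simp: nonneg_mod_def)
  note S = positive_idealD(1)[OF P \<open>p \<in> P\<close>] positive_idealD(1)[OF P \<open>q \<in> P\<close>]
  have "\<zero> \<sqsubseteq> (x \<oplus> p) \<oplus> (y \<oplus> q)" using * S by (intro add_nonneg[of "x \<oplus> p"]) auto
  then have "\<zero> \<sqsubseteq> (x \<oplus> y) \<oplus> (p \<oplus> q)" using * S by (simp add: add_ac)
  then show "x \<oplus> y \<in> nonneg_mod P"
    using * positive_idealD(4)[OF P] by (intro nonneg_modI[of "p \<oplus> q"]) auto
qed (auto simp: nonneg_mod_def)

lemma meet_in_nonneg_mod:
  assumes P: "positive_ideal P" and x: "x \<in> nonneg_mod P" and y: "y \<in> nonneg_mod P"
  shows "x \<sqinter> y \<in> nonneg_mod P"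
proof -
  obtain p q where *: "x \<in> S" "p \<in> P" "\<zero> \<sqsubseteq> x \<oplus> p" "y \<in> S" "q \<in> P" "\<zero> \<sqsubseteq> y \<oplus> q"
    using x y by (auto simp: nonneg_mod_def)
  note S = positive_idealD(1)[OF P \<open>p \<in> P\<close>] positive_idealD(1)[OF P \<open>q \<in> P\<close>]
  have nn: "\<zero> \<sqsubseteq> p" "\<zero> \<sqsubseteq> q" using positive_idealD(3)[OF P] * by auto
  have "\<zero> \<sqsubseteq> (x \<oplus> p) \<oplus> q" "\<zero> \<sqsubseteq> (y \<oplus> q) \<oplus> p"
    using * S nn by (simp_all add: add_nonneg)
  then have "\<zero> \<sqsubseteq> (x \<sqinter> y) \<oplus> (p \<oplus> q)"
    using * S by (auto simp: meet_add add_assoc add_commute[of q p] intro!: meet_greatest)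
  then show ?thesis
    using * positive_idealD(4)[OF P] by (intro nonneg_modI[of "p \<oplus> q"]) auto
qed

text \<open>Quotients by ideals are torsion-free: the negative part of \<open>x\<close> lies below that of \<open>n x\<close>, which is
  dominated by an element of \<open>P\<close>.\<close>

lemma nonneg_mod_of_mult:
  assumes P: "positive_ideal P" and x: "x \<in> S" and n: "n \<ge> 1" and nx: "mult n x \<in> nonneg_mod P"
  shows "x \<in> nonneg_mod P"
proof -
  obtain k where k: "n = Suc k" using n by (cases n) auto
  obtain p where p: "p \<in> P" "\<zero> \<sqsubseteq> mult n x \<oplus> p" using nx by (auto simp: nonneg_mod_def)
  have pS: "p \<in> S" "\<zero> \<sqsubseteq> p" using positive_idealD(1,3)[OF P] p by auto
  define v where "v = \<ominus> (x \<sqinter> \<zero>)"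
  have v: "v \<in> S" "\<zero> \<sqsubseteq> v" using x by (auto simp: v_def nonneg_neg_iff)
  have "\<ominus> mult n v = mult n x \<sqinter> \<zero>" using x by (simp add: v_def mult_neg mult_meet_zero)
  also have "\<ominus> p \<sqsubseteq> \<dots>"
  proof (rule meet_greatest)
    show "\<ominus> p \<sqsubseteq> mult n x" using p pS x nonneg_diff_iff[of "\<ominus> p" "mult n x"] by simp
    show "\<ominus> p \<sqsubseteq> \<zero>" using pS nonneg_neg_iff[of "\<ominus> p"] by simp
  qed (use x pS in auto)
  finally have "mult n v \<sqsubseteq> p" using v pS by (simp add: neg_le_iff)
  moreover have "v \<sqsubseteq> mult n v" using add_mono[of v v \<zero> "mult k v"] v mult_nonneg k by simp
  ultimately have "v \<in> P"
    using positive_idealD(5)[OF P p(1)] v pS le_trans[of v "mult n v" p] by auto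
  moreover have "\<zero> \<sqsubseteq> x \<oplus> v" using x nonneg_diff_iff[of "x \<sqinter> \<zero>" x] by (simp add: v_def)
  ultimately show ?thesis using x by (intro nonneg_modI[of v]) auto
qed

text \<open>Modulo a prime ideal the order is total, and meets are minima.\<close>

lemma prime_ideal_meet:
  assumes P: "prime_ideal P" and S: "x \<in> S" "y \<in> S"
  shows "(x \<sqinter> y) \<oplus> \<ominus> x \<in> nonneg_mod P \<or> (x \<sqinter> y) \<oplus> \<ominus> y \<in> nonneg_mod P"
proof -
  let ?u = "x \<oplus> \<ominus> (x \<sqinter> y)" and ?v = "y \<oplus> \<ominus> (x \<sqinter> y)"
  have "?u \<sqinter> ?v = \<zero>" using S by (simp flip: meet_add)
  then have "?u \<in> P \<or> ?v \<in> P" using P S by (simp add: prime_ideal_def)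
  moreover have "(x \<sqinter> y) \<oplus> \<ominus> z \<in> nonneg_mod P"
    if "z \<in> S" "z \<oplus> \<ominus> (x \<sqinter> y) \<in> P" for z
    using that S by (intro nonneg_modI[OF that(2)]) (auto simp: diff_add_diff)
  ultimately show ?thesis using S by blast
qed

text \<open>An ideal \<open>P\<close> maximal among those that are disjoint from \<open>F\<close> is prime. If \<open>x \<sqinter> y = \<zero>\<close> with neither
  \<open>x\<close> nor \<open>y\<close> in \<open>P\<close>, then some \<open>f, f' \<in> F\<close> lie below \<open>p + m x\<close> and \<open>p' + n y\<close>; so \<open>f \<sqinter> f'\<close> lies below
  \<open>(p + p') + (m x \<sqinter> n y) = p + p'\<close> and belongs to \<open>P\<close>.\<close>

lemma prime_ideal_avoiding:
  assumes F: "F \<subseteq> S" "\<And>f. f \<in> F \<Longrightarrow> \<zero> \<sqsubseteq> f" "\<zero> \<notin> F"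
    and Fm: "\<And>f f'. f \<in> F \<Longrightarrow> f' \<in> F \<Longrightarrow> f \<sqinter> f' \<in> F"
  obtains P where "prime_ideal P" "P \<inter> F = {}"
proof -
  let ?\<A> = "{P. positive_ideal P \<and> P \<inter> F = {}}"
  have "\<exists>P\<in>?\<A>. \<forall>X\<in>?\<A>. P \<subseteq> X \<longrightarrow> X = P"
  proof (rule subset_Zorn_nonempty)
    have "positive_ideal {\<zero>}" by (auto simp: positive_ideal_def intro: le_antisym)
    then show "?\<A> \<noteq> {}" using F by blast
  next
    fix \<C> assume ne: "\<C> \<noteq> {}" and ch: "subset.chain ?\<A> \<C>"
    have sub: "positive_ideal P" "P \<inter> F = {}" if "P \<in> \<C>" for P
      using ch that by (auto simp: subset.chain_def)
    have add: "x \<oplus> y \<in> \<Union>\<C>" if "x \<in> P" "P \<in> \<C>" "y \<in> P'" "P' \<in> \<C>" for x y P P'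
    proof -
      have "P \<subseteq> P' \<or> P' \<subseteq> P" using ch that unfolding subset_chain_def by blast
      then show ?thesis using that sub(1)[of P] sub(1)[of P'] unfolding positive_ideal_def
        by (meson UnionI subsetD)
    qed
    have down: "x \<in> \<Union>\<C>" if "p \<in> P" "P \<in> \<C>" "x \<in> S" "\<zero> \<sqsubseteq> x" "x \<sqsubseteq> p" for x p P
      using positive_idealD(5)[OF sub(1)] that by blast
    have "positive_ideal (\<Union>\<C>)"
      unfolding positive_ideal_def
    proof (intro conjI ballI impI)
      show "\<Union>\<C> \<subseteq> S" using positive_idealD(1)[OF sub(1)] by blast
      show "\<zero> \<in> \<Union>\<C>" using positive_idealD(2)[OF sub(1)] ne by blast
      show "\<zero> \<sqsubseteq> p" if "p \<in> \<Union>\<C>" for p using positive_idealD(3)[OF sub(1)] that by blast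
    qed (use add down in blast)+
    then show "\<Union>\<C> \<in> ?\<A>" using sub(2) by auto
  qed
  then obtain P where P: "positive_ideal P" "P \<inter> F = {}"
    and max: "\<And>X. positive_ideal X \<Longrightarrow> X \<inter> F = {} \<Longrightarrow> P \<subseteq> X \<Longrightarrow> X = P"
    by auto
  note PD = positive_idealD[OF P(1)]
  have hit: "\<exists>f\<in>F. \<exists>p\<in>P. \<exists>n. f \<sqsubseteq> p \<oplus> mult n x" if x: "x \<in> S" "x \<notin> P" "\<zero> \<sqsubseteq> x" for x
  proof -
    let ?X = "{z \<in> S. \<zero> \<sqsubseteq> z \<and> (\<exists>p\<in>P. \<exists>n. z \<sqsubseteq> p \<oplus> mult n x)}"
    have "u \<oplus> v \<in> ?X" if uv: "u \<in> ?X" "v \<in> ?X" for u v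
    proof -
      obtain p m q n where *: "p \<in> P" "u \<sqsubseteq> p \<oplus> mult m x" "q \<in> P" "v \<sqsubseteq> q \<oplus> mult n x"
        using uv by blast
      have "u \<oplus> v \<sqsubseteq> (p \<oplus> mult m x) \<oplus> (q \<oplus> mult n x)"
        using * uv x PD(1) by (intro add_mono) auto
      also have "\<dots> = (p \<oplus> q) \<oplus> mult (m + n) x"
        using * x PD(1) by (simp add: mult_plus add_ac)
      finally show ?thesis using * uv x PD(4) by (auto intro: add_nonneg)
    qed
    moreover have "z \<in> ?X" if u: "u \<in> ?X" and z: "z \<in> S" "\<zero> \<sqsubseteq> z" "z \<sqsubseteq> u" for u z
    proof -
      obtain p m where *: "p \<in> P" "u \<sqsubseteq> p \<oplus> mult m x" using u by blast
      have "z \<sqsubseteq> p \<oplus> mult m x" by (rule le_trans[of _ u]) (use * u z x PD(1) in auto)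
      then show ?thesis using * z by blast
    qed
    moreover have sub: "P \<subseteq> ?X"
    proof
      fix p assume p: "p \<in> P"
      then have "p \<sqsubseteq> p \<oplus> mult 0 x" using PD(1) by simp
      then show "p \<in> ?X" using p PD(1,3) by blast
    qed
    ultimately have id: "positive_ideal ?X"
      using PD(2) unfolding positive_ideal_def by (intro conjI ballI impI) blast+
    have "x \<sqsubseteq> \<zero> \<oplus> mult 1 x" using x by simp
    then have "x \<in> ?X" using x PD(2) by blast
    then have "?X \<inter> F \<noteq> {}" using max[OF id _ sub] x by blast
    then show ?thesis by blast
  qed
  have "x \<in> P \<or> y \<in> P" if xy: "x \<in> S" "y \<in> S" "x \<sqinter> y = \<zero>" for x y
  proof (rule ccontr)
    assume "\<not> (x \<in> P \<or> y \<in> P)"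
    then obtain f p m f' p' n where
      1: "f \<in> F" "p \<in> P" "f \<sqsubseteq> p \<oplus> mult m x" and 2: "f' \<in> F" "p' \<in> P" "f' \<sqsubseteq> p' \<oplus> mult n y"
      using hit[of x] hit[of y] xy disjoint_nonneg[of x y] by blast
    have S: "f \<in> S" "f' \<in> S" "p \<in> S" "p' \<in> S" using 1 2 F PD(1) by auto
    have le1: "f \<sqinter> f' \<sqsubseteq> mult m x \<oplus> (p \<oplus> p')"
    proof (rule le_trans[of _ f])
      have "f \<oplus> \<zero> \<sqsubseteq> (p \<oplus> mult m x) \<oplus> p'" using 1 2 S xy PD(3) by (intro add_mono) auto
      then show "f \<sqsubseteq> mult m x \<oplus> (p \<oplus> p')" using S xy by (simp add: add_ac)
    qed (use S xy in auto)
    have le2: "f \<sqinter> f' \<sqsubseteq> mult n y \<oplus> (p \<oplus> p')"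
    proof (rule le_trans[of _ f'])
      have "f' \<oplus> \<zero> \<sqsubseteq> (p' \<oplus> mult n y) \<oplus> p" using 1 2 S xy PD(3) by (intro add_mono) auto
      then show "f' \<sqsubseteq> mult n y \<oplus> (p \<oplus> p')" using S xy by (simp add: add_ac)
    qed (use S xy in auto)
    have "f \<sqinter> f' \<sqsubseteq> (mult m x \<oplus> (p \<oplus> p')) \<sqinter> (mult n y \<oplus> (p \<oplus> p'))"
      using le1 le2 S xy by (intro meet_greatest) auto
    also have "\<dots> = p \<oplus> p'" using S xy by (simp add: disjoint_mult flip: meet_add)
    finally have "f \<sqinter> f' \<in> P" using PD(4)[of p p'] 1 2 Fm[of f f'] F by (auto intro: PD(5))
    then show False using P(2) Fm[of f f'] 1 2 by blast
  qed
  then show thesis using that[of P] P by (simp add: prime_ideal_def)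
qed

text \<open>If \<open>C\<close> could interpolate \<open>b\<close> at every pair \<open>P, Q\<close>, a lattice form of the Stone-Weierstrass argument
  would place \<open>b\<close> in \<open>C\<close>: finite meets of interpolants yield elements of \<open>C\<close> below \<open>b\<close> that agree
  with \<open>b\<close> at \<open>P\<close>, and finite joins of those yield \<open>b\<close>. Read backwards, with prime ideals in the role of
  compactness, \<open>P\<close> is chosen so that no \<open>c \<in> C\<close> below \<open>b\<close> agrees with \<open>b\<close> modulo \<open>P\<close>, and \<open>Q\<close> so
  that no \<open>c \<in> C\<close> with \<open>b \<sqsubseteq> c\<close> modulo \<open>P\<close> lies below \<open>b\<close> modulo \<open>Q\<close>.\<close>

lemma prime_ideals_separating:
  assumes CS: "C \<subseteq> S" and b: "b \<in> S" "b \<notin> C"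
    and Cm: "\<And>c d. c \<in> C \<Longrightarrow> d \<in> C \<Longrightarrow> c \<sqinter> d \<in> C"
    and Cj: "\<And>c d. c \<in> C \<Longrightarrow> d \<in> C \<Longrightarrow> c \<squnion> d \<in> C"
  obtains P Q where "prime_ideal P" "prime_ideal Q"
    "\<And>c. c \<in> C \<Longrightarrow> c \<oplus> \<ominus> b \<in> nonneg_mod P \<Longrightarrow> b \<oplus> \<ominus> c \<in> nonneg_mod Q \<Longrightarrow> False"
proof -
  let ?F = "{f \<in> S. \<zero> \<sqsubseteq> f \<and> (\<exists>c\<in>C. c \<sqsubseteq> b \<and> b \<oplus> \<ominus> c \<sqsubseteq> f)}"
  obtain P where P: "prime_ideal P" "P \<inter> ?F = {}"
  proof (rule prime_ideal_avoiding[of ?F])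
    show "\<zero> \<notin> ?F"
    proof
      assume "\<zero> \<in> ?F"
      then obtain c where "c \<in> C" "c \<sqsubseteq> b" "b \<oplus> \<ominus> c \<sqsubseteq> \<zero>" by blast
      then have "b = c" using CS b by (intro le_antisym) (auto simp: diff_le_iff)
      then show False using \<open>c \<in> C\<close> b by simp
    qed
  next
    fix f f' assume "f \<in> ?F" "f' \<in> ?F"
    then obtain c c' where *: "f \<in> S" "f' \<in> S" "\<zero> \<sqsubseteq> f" "\<zero> \<sqsubseteq> f'"
      "c \<in> C" "c \<sqsubseteq> b" "b \<oplus> \<ominus> c \<sqsubseteq> f" "c' \<in> C" "c' \<sqsubseteq> b" "b \<oplus> \<ominus> c' \<sqsubseteq> f'" by blast
    have S: "c \<in> S" "c' \<in> S" using * CS by auto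
    have "b \<oplus> \<ominus> (c \<squnion> c') \<sqsubseteq> b \<oplus> \<ominus> c" "b \<oplus> \<ominus> (c \<squnion> c') \<sqsubseteq> b \<oplus> \<ominus> c'"
      using S b by (auto simp: neg_le_iff)
    then have "b \<oplus> \<ominus> (c \<squnion> c') \<sqsubseteq> f \<sqinter> f'"
      using * S b le_trans[of "b \<oplus> \<ominus> (c \<squnion> c')" "b \<oplus> \<ominus> c" f]
        le_trans[of "b \<oplus> \<ominus> (c \<squnion> c')" "b \<oplus> \<ominus> c'" f'] by (intro meet_greatest) auto
    moreover have "c \<squnion> c' \<sqsubseteq> b" using * S b by (intro join_least) auto
    ultimately show "f \<sqinter> f' \<in> ?F" using * Cj by (auto intro: meet_greatest)
  qed auto
  have Pi: "positive_ideal P" using P by (simp add: prime_ideal_def)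
  let ?G = "{f \<in> S. \<zero> \<sqsubseteq> f \<and> (\<exists>c\<in>C. c \<oplus> \<ominus> b \<in> nonneg_mod P \<and> c \<oplus> \<ominus> b \<sqsubseteq> f)}"
  obtain Q where Q: "prime_ideal Q" "Q \<inter> ?G = {}"
  proof (rule prime_ideal_avoiding[of ?G])
    show "\<zero> \<notin> ?G"
    proof
      assume "\<zero> \<in> ?G"
      then obtain c where c: "c \<in> C" "c \<oplus> \<ominus> b \<in> nonneg_mod P" "c \<oplus> \<ominus> b \<sqsubseteq> \<zero>" by blast
      then have cS: "c \<in> S" using CS by auto
      have cb: "c \<sqsubseteq> b" using c b cS by (simp add: diff_le_iff)
      obtain p where p: "p \<in> P" "\<zero> \<sqsubseteq> c \<oplus> \<ominus> b \<oplus> p" using c by (auto simp: nonneg_mod_def)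
      have pS: "p \<in> S" using p Pi positive_idealD by blast
      have "\<zero> \<sqsubseteq> p \<oplus> \<ominus> (b \<oplus> \<ominus> c)" using p pS b cS by (simp add: neg_diff add_commute)
      then have "b \<oplus> \<ominus> c \<sqsubseteq> p" using pS b cS by (simp add: nonneg_diff_iff)
      moreover have "\<zero> \<sqsubseteq> b \<oplus> \<ominus> c" using cb b cS by (simp add: nonneg_diff_iff)
      ultimately have "b \<oplus> \<ominus> c \<in> P" using positive_idealD(5)[OF Pi p(1)] b cS by auto
      moreover have "b \<oplus> \<ominus> c \<in> ?F" using cb c(1) b cS by (auto simp: nonneg_diff_iff)
      ultimately show False using P by blast
    qed
  next
    fix f f' assume "f \<in> ?G" "f' \<in> ?G"
    then obtain c c' where *: "f \<in> S" "f' \<in> S" "\<zero> \<sqsubseteq> f" "\<zero> \<sqsubseteq> f'"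
      "c \<in> C" "c \<oplus> \<ominus> b \<in> nonneg_mod P" "c \<oplus> \<ominus> b \<sqsubseteq> f"
      "c' \<in> C" "c' \<oplus> \<ominus> b \<in> nonneg_mod P" "c' \<oplus> \<ominus> b \<sqsubseteq> f'" by blast
    have S: "c \<in> S" "c' \<in> S" using * CS by auto
    have eq: "(c \<sqinter> c') \<oplus> \<ominus> b = (c \<oplus> \<ominus> b) \<sqinter> (c' \<oplus> \<ominus> b)" using S b by (simp add: meet_add)
    have "(c \<sqinter> c') \<oplus> \<ominus> b \<sqsubseteq> c \<oplus> \<ominus> b" "(c \<sqinter> c') \<oplus> \<ominus> b \<sqsubseteq> c' \<oplus> \<ominus> b" using S b by auto
    then have "(c \<sqinter> c') \<oplus> \<ominus> b \<sqsubseteq> f \<sqinter> f'"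
      using * S b le_trans[of "(c \<sqinter> c') \<oplus> \<ominus> b" "c \<oplus> \<ominus> b" f]
        le_trans[of "(c \<sqinter> c') \<oplus> \<ominus> b" "c' \<oplus> \<ominus> b" f'] by (intro meet_greatest) auto
    moreover have "(c \<sqinter> c') \<oplus> \<ominus> b \<in> nonneg_mod P" unfolding eq by (rule meet_in_nonneg_mod) (use Pi * in auto)
    ultimately show "f \<sqinter> f' \<in> ?G" using * Cm by (auto intro: meet_greatest)
  qed auto
  have "False" if c: "c \<in> C" "c \<oplus> \<ominus> b \<in> nonneg_mod P" "b \<oplus> \<ominus> c \<in> nonneg_mod Q" for c
  proof -
    obtain q where q: "q \<in> Q" "\<zero> \<sqsubseteq> b \<oplus> \<ominus> c \<oplus> q" using c by (auto simp: nonneg_mod_def)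
    have Qi: "positive_ideal Q" using Q by (simp add: prime_ideal_def)
    have qS: "q \<in> S" "\<zero> \<sqsubseteq> q" using q Qi positive_idealD by blast+
    have cS: "c \<in> S" using c CS by auto
    have "\<zero> \<sqsubseteq> q \<oplus> \<ominus> (c \<oplus> \<ominus> b)" using q qS b cS by (simp add: neg_diff add_commute)
    then have "c \<oplus> \<ominus> b \<sqsubseteq> q" using qS b cS by (simp add: nonneg_diff_iff)
    then have "q \<in> ?G" using qS c by blast
    then show False using Q q by blast
  qed
  then show thesis using that P(1) Q(1) by blast
qed

end

section \<open>Algebras in the language of Abelian lattice-ordered groups\<close>

lemma lAG_iff:
  "A \<in> lAG \<longleftrightarrow> A \<in> small_algebras lg_lang \<and>
     lattice_group_on (carrier A) (lplus A) (lminus A) (lzero A) (lmeet A) (ljoin A)"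
proof
  assume A: "A \<in> lAG"
  then have alg: "algebra lg_lang A" by (simp add: lAG_def small_algebras_def)
  have closed: "lplus A x y \<in> carrier A" "lmeet A x y \<in> carrier A" "ljoin A x y \<in> carrier A"
    "lminus A x \<in> carrier A" "lzero A \<in> carrier A"
    if "x \<in> carrier A" "y \<in> carrier A" for x y
    using alg that by (auto simp: algebra_def lplus_def lmeet_def ljoin_def lminus_def lzero_def)
  obtain a where a: "a \<in> carrier A" using alg by (auto simp: algebra_def)
  note axioms = A[unfolded lAG_def lle_def mem_Collect_eq, THEN conjunct2]
  have "lattice_group_on (carrier A) (lplus A) (lminus A) (lzero A) (lmeet A) (ljoin A)"
    by unfold_locales (use a closed axioms in metis)+
  then show "A \<in> small_algebras lg_lang \<and>
     lattice_group_on (carrier A) (lplus A) (lminus A) (lzero A) (lmeet A) (ljoin A)"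
    using A unfolding lAG_def by blast
next
  assume A: "A \<in> small_algebras lg_lang \<and>
     lattice_group_on (carrier A) (lplus A) (lminus A) (lzero A) (lmeet A) (ljoin A)"
  then interpret lattice_group_on "carrier A" "lplus A" "lminus A" "lzero A" "lmeet A" "ljoin A"
    by blast
  show "A \<in> lAG"
    using A unfolding lAG_def lle_def mem_Collect_eq
    by (auto simp: add_assoc meet_assoc join_assoc meet_join join_meet meet_add_mono
        intro: add_commute meet_commute join_commute)
qed

definition lg_alg ::
  "'u set \<Rightarrow> ('u \<Rightarrow> 'u \<Rightarrow> 'u) \<Rightarrow> ('u \<Rightarrow> 'u) \<Rightarrow> 'u \<Rightarrow> ('u \<Rightarrow> 'u \<Rightarrow> 'u) \<Rightarrow> ('u \<Rightarrow> 'u \<Rightarrow> 'u)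
    \<Rightarrow> ('s lg_sym, 'u) alg" where
  "lg_alg S add neg zero meet join =
    \<lparr>carrier = S,
     interp = (\<lambda>s xs. if lg_lang s = Some (length xs) \<and> set xs \<subseteq> S then
        (case s of Plus \<Rightarrow> add (xs ! 0) (xs ! 1) | Minus \<Rightarrow> neg (xs ! 0) | Zero \<Rightarrow> zero
          | Meet \<Rightarrow> meet (xs ! 0) (xs ! 1) | Join \<Rightarrow> join (xs ! 0) (xs ! 1) | Extra _ \<Rightarrow> undefined)
        else undefined)\<rparr>"

lemma lg_alg_ops:
  fixes S :: "'u set" and add meet join :: "'u \<Rightarrow> 'u \<Rightarrow> 'u" and neg :: "'u \<Rightarrow> 'u" and zero :: 'u
  defines "A \<equiv> lg_alg S add neg zero meet join"
  shows "carrier A = S"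
    "x \<in> S \<Longrightarrow> y \<in> S \<Longrightarrow> lplus A x y = add x y"
    "x \<in> S \<Longrightarrow> y \<in> S \<Longrightarrow> lmeet A x y = meet x y"
    "x \<in> S \<Longrightarrow> y \<in> S \<Longrightarrow> ljoin A x y = join x y"
    "x \<in> S \<Longrightarrow> lminus A x = neg x"
    "lzero A = zero"
  by (auto simp: A_def lg_alg_def lplus_def lmeet_def ljoin_def lminus_def lzero_def)

lemma lg_alg_in_lAG:
  fixes S :: "'u set"
  assumes lg: "lattice_group_on S add neg zero meet join" and small: "S \<prec> (UNIV :: 'u set)"
  shows "(lg_alg S add neg zero meet join :: ('s lg_sym, 'u) alg) \<in> lAG"
proof -
  interpret lattice_group_on S add neg zero meet join by (rule lg)
  let ?A = "lg_alg S add neg zero meet join :: ('s lg_sym, 'u) alg"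
  have "algebra lg_lang ?A"
    unfolding algebra_def
  proof (intro conjI allI impI)
    show "carrier ?A \<noteq> {}" using zero_closed by (auto simp: lg_alg_def)
    fix s :: "'s lg_sym" and xs :: "'u list"
    show "interp ?A s xs \<in> carrier ?A" 
      if *: "lg_lang s = Some (length xs) \<and> set xs \<subseteq> carrier ?A"
    proof (cases s)
      case Plus
      then obtain x y where "xs = [x, y]" using * by (auto simp: numeral_2_eq_2 length_Suc_conv Suc_length_conv)
      then show ?thesis using Plus * by (simp add: lg_alg_def)
    next
      case Meet
      then obtain x y where "xs = [x, y]" using * by (auto simp: numeral_2_eq_2 length_Suc_conv Suc_length_conv)
      then show ?thesis using Meet * by (simp add: lg_alg_def)
    next
      case Join
      then obtain x y where "xs = [x, y]" using * by (auto simp: numeral_2_eq_2 length_Suc_conv Suc_length_conv)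
      then show ?thesis using Join * by (simp add: lg_alg_def)
    next
      case Minus
      then obtain x where "xs = [x]" using * by (auto simp: length_Suc_conv Suc_length_conv)
      then show ?thesis using Minus * by (simp add: lg_alg_def)
    qed (use * in \<open>auto simp: lg_alg_def\<close>)
    show "interp ?A s xs = undefined" if "\<not> (lg_lang s = Some (length xs) \<and> set xs \<subseteq> carrier ?A)"
      using that by (auto simp: lg_alg_def)
  qed
  moreover have "lattice_group_on (carrier ?A) (lplus ?A) (lminus ?A) (lzero ?A) (lmeet ?A) (ljoin ?A)"
    by unfold_locales
      (auto simp: lg_alg_ops add_assoc meet_assoc join_assoc meet_join join_meet meet_add_mono
        intro: add_commute meet_commute join_commute)
  ultimately show ?thesis using small by (simp add: lAG_iff small_algebras_def lg_alg_ops)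
qed

text \<open>Group homomorphisms that preserve meets preserve joins, which are negated meets of negatives.\<close>

lemma lg_homI:
  assumes A: "A \<in> lAG" and B: "B \<in> lAG" and h: "\<And>x. x \<in> carrier A \<Longrightarrow> h x \<in> carrier B"
    and plus: "\<And>x y. x \<in> carrier A \<Longrightarrow> y \<in> carrier A \<Longrightarrow> h (lplus A x y) = lplus B (h x) (h y)"
    and meet: "\<And>x y. x \<in> carrier A \<Longrightarrow> y \<in> carrier A \<Longrightarrow> h (lmeet A x y) = lmeet B (h x) (h y)"
  shows "h \<in> hom lg_lang A B"
proof -
  interpret A: lattice_group_on "carrier A" "lplus A" "lminus A" "lzero A" "lmeet A" "ljoin A"
    using A by (simp add: lAG_iff)
  interpret B: lattice_group_on "carrier B" "lplus B" "lminus B" "lzero B" "lmeet B" "ljoin B"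
    using B by (simp add: lAG_iff)
  have "lplus B (h (lzero A)) (h (lzero A)) = h (lzero A)"
    using plus[of "lzero A" "lzero A"] by simp
  then have zero: "h (lzero A) = lzero B"
    using h by (metis A.zero_closed B.add_neg B.add_neg_cancel_right)
  have minus: "h (lminus A x) = lminus B (h x)" if "x \<in> carrier A" for x
    using plus[of x "lminus A x"] that h zero by (metis A.add_neg A.neg_closed B.neg_unique)
  have join: "h (ljoin A x y) = ljoin B (h x) (h y)" if "x \<in> carrier A" "y \<in> carrier A" for x y
    using that h by (simp add: A.join_eq_neg_meet B.join_eq_neg_meet minus meet)
  have "h (interp A s xs) = interp B s (map h xs)"
    if *: "lg_lang s = Some (length xs)" "set xs \<subseteq> carrier A" for s and xs
  proof (cases s)
    case Plus
    then obtain x y where "xs = [x, y]" using * by (auto simp: numeral_2_eq_2 length_Suc_conv Suc_length_conv)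
    then show ?thesis using * plus Plus by (simp add: lplus_def)
  next
    case Meet
    then obtain x y where "xs = [x, y]" using * by (auto simp: numeral_2_eq_2 length_Suc_conv Suc_length_conv)
    then show ?thesis using * meet Meet by (simp add: lmeet_def)
  next
    case Join
    then obtain x y where "xs = [x, y]" using * by (auto simp: numeral_2_eq_2 length_Suc_conv Suc_length_conv)
    then show ?thesis using * join Join by (simp add: ljoin_def)
  next
    case Minus
    then obtain x where "xs = [x]" using * by (auto simp: length_Suc_conv Suc_length_conv)
    then show ?thesis using * minus Minus by (simp add: lminus_def)
  next
    case Zero
    then show ?thesis using * zero by (simp add: lzero_def)
  qed (use * in auto)
  then show ?thesis using h unfolding hom_def by blast
qed

section \<open>Totally ordered quotients\<close>

lemma lattice_group_on_chain:
  assumes "abelian_group_on S add neg zero"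
    and total: "\<And>x y. x \<in> S \<Longrightarrow> y \<in> S \<Longrightarrow> R x y \<or> R y x"
    and antisym: "\<And>x y. x \<in> S \<Longrightarrow> y \<in> S \<Longrightarrow> R x y \<Longrightarrow> R y x \<Longrightarrow> x = y"
    and trans: "\<And>x y z. x \<in> S \<Longrightarrow> y \<in> S \<Longrightarrow> z \<in> S \<Longrightarrow> R x y \<Longrightarrow> R y z \<Longrightarrow> R x z"
    and mono: "\<And>x y z. x \<in> S \<Longrightarrow> y \<in> S \<Longrightarrow> z \<in> S \<Longrightarrow> R x y \<Longrightarrow> R (add x z) (add y z)"
  shows "lattice_group_on S add neg zero
    (\<lambda>x y. if R x y then x else y) (\<lambda>x y. if R x y then y else x)"
proof -
  interpret abelian_group_on S add neg zero by fact
  show ?thesis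
  proof (unfold_locales, goal_cases)
    case (9 x y z)
    show ?case
    proof (cases "R x y")
      case True
      then show ?thesis using mono[of x y z] 9 by auto
    next
      case False
      then show ?thesis using 9 by auto
    qed
  next
    case (3 x y z)
    then show ?case using trans[of x y z] trans[of x z y] total[of y z] by auto
  next
    case (5 x y z)
    then show ?case using trans[of x y z] trans[of x z y] total[of y z] by auto
  next
    case (4 x y)
    then show ?case using total[of x y] antisym[of x y] by auto
  next
    case (6 x y)
    then show ?case using total[of x y] antisym[of x y] by auto
  qed simp_all
qed

text \<open>\<open>D\<close> is the quotient of the group by the equivalence of the total preorder with cone \<open>M\<close>, and
  \<open>\<kappa>\<close> is the quotient map. The class of \<open>x\<close> is encoded in the universe by the \<open>\<psi>\<close>-value of a chosen
  representative.\<close>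

lemma (in abelian_group_on) total_quotient:
  fixes \<psi> :: "'a \<Rightarrow> 'u"
  assumes M: "submonoid M" and total: "\<And>x. x \<in> S \<Longrightarrow> x \<in> M \<or> \<ominus> x \<in> M"
    and inj: "inj_on \<psi> S" and small: "\<psi> ` S \<prec> (UNIV :: 'u set)"
  obtains D :: "('s lg_sym, 'u) alg" and \<kappa> where "D \<in> lAG" "carrier D = \<kappa> ` S"
    "\<And>x y. x \<in> S \<Longrightarrow> y \<in> S \<Longrightarrow> \<kappa> x = \<kappa> y \<longleftrightarrow> x \<oplus> \<ominus> y \<in> M \<and> y \<oplus> \<ominus> x \<in> M"
    "\<And>x y. x \<in> S \<Longrightarrow> y \<in> S \<Longrightarrow> lplus D (\<kappa> x) (\<kappa> y) = \<kappa> (x \<oplus> y)"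
    "\<And>x y. x \<in> S \<Longrightarrow> y \<in> S \<Longrightarrow> lle D (\<kappa> x) (\<kappa> y) \<longleftrightarrow> y \<oplus> \<ominus> x \<in> M"
proof -
  have Mz: "\<zero> \<in> M" and Madd: "\<And>x y. x \<in> M \<Longrightarrow> y \<in> M \<Longrightarrow> x \<oplus> y \<in> M"
    using M by (auto simp: submonoid_def)
  define E where "E x y \<longleftrightarrow> x \<oplus> \<ominus> y \<in> M \<and> y \<oplus> \<ominus> x \<in> M" for x y
  define rep where "rep x = (SOME y. y \<in> S \<and> E x y)" for x
  define \<kappa> where "\<kappa> x = \<psi> (rep x)" for x
  have Esym: "E x y \<Longrightarrow> E y x" for x y by (simp add: E_def)
  have Etrans: "E x z" if "x \<in> S" "y \<in> S" "z \<in> S" "E x y" "E y z" for x y z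
    using that Madd[of "x \<oplus> \<ominus> y" "y \<oplus> \<ominus> z"] Madd[of "z \<oplus> \<ominus> y" "y \<oplus> \<ominus> x"]
    by (simp add: E_def diff_add_diff)
  have rep: "rep x \<in> S \<and> E x (rep x)" if "x \<in> S" for x
    unfolding rep_def by (rule someI[of _ x]) (simp add: that E_def Mz)
  have \<kappa>_E: "\<kappa> x = \<kappa> y \<longleftrightarrow> E x y" if xy: "x \<in> S" "y \<in> S" for x y
  proof
    assume "\<kappa> x = \<kappa> y"
    then have "rep x = rep y" using inj rep xy by (auto simp: \<kappa>_def dest: inj_onD)
    then show "E x y" using rep[OF xy(1)] rep[OF xy(2)] Etrans[of x "rep x" y] Esym xy by metis
  next
    assume "E x y"
    then have "z \<in> S \<and> E x z \<longleftrightarrow> z \<in> S \<and> E y z" for z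
      using Etrans[of x y z] Etrans[of y x z] Esym[of x y] xy by blast
    then show "\<kappa> x = \<kappa> y" by (simp add: \<kappa>_def rep_def)
  qed
  note \<kappa> = \<kappa>_E[unfolded E_def]
  have "\<kappa> ` S \<subseteq> \<psi> ` S" using rep by (auto simp: \<kappa>_def)
  then have small': "\<kappa> ` S \<prec> (UNIV :: 'u set)"
    using small lesspoll_trans1 subset_imp_lepoll by blast
  define \<iota> where "\<iota> = inv_into S \<kappa>"
  have \<iota>S: "\<iota> (\<kappa> x) \<in> S" and \<kappa>\<iota>: "\<kappa> (\<iota> (\<kappa> x)) = \<kappa> x" if "x \<in> S" for x
    using that unfolding \<iota>_def by (auto intro: inv_into_into f_inv_into_f)
  define add' where "add' u v = \<kappa> (\<iota> u \<oplus> \<iota> v)" for u v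
  define neg' where "neg' u = \<kappa> (\<ominus> \<iota> u)" for u
  define R where "R u v \<longleftrightarrow> \<iota> v \<oplus> \<ominus> \<iota> u \<in> M" for u v
  have cong_add: "\<kappa> (x \<oplus> y) = \<kappa> (x' \<oplus> y')"
    if S: "x \<in> S" "y \<in> S" "x' \<in> S" "y' \<in> S" and eq: "\<kappa> x = \<kappa> x'" "\<kappa> y = \<kappa> y'" for x y x' y'
    using S eq \<kappa>[of x x'] \<kappa>[of y y'] Madd by (simp add: \<kappa> add_diff_add)
  have cong_neg: "\<kappa> (\<ominus> x) = \<kappa> (\<ominus> x')" if S: "x \<in> S" "x' \<in> S" and eq: "\<kappa> x = \<kappa> x'" for x x'
    using S eq by (simp add: \<kappa> add_commute)
  have add': "add' (\<kappa> x) (\<kappa> y) = \<kappa> (x \<oplus> y)" if "x \<in> S" "y \<in> S" for x y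
    unfolding add'_def by (rule cong_add) (use that \<iota>S \<kappa>\<iota> in auto)
  have neg': "neg' (\<kappa> x) = \<kappa> (\<ominus> x)" if "x \<in> S" for x
    unfolding neg'_def by (rule cong_neg) (use that \<iota>S \<kappa>\<iota> in auto)
  have cong_M: "y' \<oplus> \<ominus> x' \<in> M"
    if S: "x \<in> S" "y \<in> S" "x' \<in> S" "y' \<in> S" and eq: "\<kappa> x = \<kappa> x'" "\<kappa> y = \<kappa> y'"
      and xy: "y \<oplus> \<ominus> x \<in> M" for x y x' y'
  proof -
    have "(y' \<oplus> \<ominus> y) \<oplus> ((y \<oplus> \<ominus> x) \<oplus> (x \<oplus> \<ominus> x')) \<in> M"
      using S eq \<kappa>[of x x'] \<kappa>[of y y'] Madd xy by simp
    then show ?thesis using S by (simp add: diff_add_diff)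
  qed
  have R: "R (\<kappa> x) (\<kappa> y) \<longleftrightarrow> y \<oplus> \<ominus> x \<in> M" if "x \<in> S" "y \<in> S" for x y
    unfolding R_def
  proof
    assume *: "\<iota> (\<kappa> y) \<oplus> \<ominus> \<iota> (\<kappa> x) \<in> M"
    show "y \<oplus> \<ominus> x \<in> M" by (rule cong_M[OF _ _ _ _ _ _ *]) (use that \<iota>S \<kappa>\<iota> in auto)
  next
    assume *: "y \<oplus> \<ominus> x \<in> M"
    show "\<iota> (\<kappa> y) \<oplus> \<ominus> \<iota> (\<kappa> x) \<in> M" by (rule cong_M[OF _ _ _ _ _ _ *]) (use that \<iota>S \<kappa>\<iota> in auto)
  qed
  have grp: "abelian_group_on (\<kappa> ` S) add' neg' (\<kappa> \<zero>)"
    by unfold_locales (auto simp: add' neg' add_ac)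
  let ?meet = "\<lambda>u v. if R u v then u else v" and ?join = "\<lambda>u v. if R u v then v else u"
  have lg: "lattice_group_on (\<kappa> ` S) add' neg' (\<kappa> \<zero>) ?meet ?join"
  proof (rule lattice_group_on_chain[OF grp])
    fix u v assume "u \<in> \<kappa> ` S" "v \<in> \<kappa> ` S"
    then obtain x y where xy: "x \<in> S" "y \<in> S" "u = \<kappa> x" "v = \<kappa> y" by auto
    show "R u v \<or> R v u" using total[of "y \<oplus> \<ominus> x"] xy by (simp add: R neg_diff)
    show "u = v" if "R u v" "R v u" using that xy by (simp add: R \<kappa>)
    fix w assume "w \<in> \<kappa> ` S"
    then obtain z where z: "z \<in> S" "w = \<kappa> z" by auto
    show "R u w" if "R u v" "R v w"
      using that xy z Madd[of "z \<oplus> \<ominus> y" "y \<oplus> \<ominus> x"] by (simp add: R diff_add_diff)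
    show "R (add' u w) (add' v w)" if "R u v"
      using that xy z by (simp add: R add' add_diff_add)
  qed
  let ?D = "lg_alg (\<kappa> ` S) add' neg' (\<kappa> \<zero>) ?meet ?join :: ('s lg_sym, 'u) alg"
  show thesis
  proof (rule that[of ?D \<kappa>])
    show "?D \<in> lAG" by (rule lg_alg_in_lAG[OF lg small'])
    show "carrier ?D = \<kappa> ` S" by (simp add: lg_alg_ops)
    fix x y assume xy: "x \<in> S" "y \<in> S"
    then show "\<kappa> x = \<kappa> y \<longleftrightarrow> x \<oplus> \<ominus> y \<in> M \<and> y \<oplus> \<ominus> x \<in> M" by (rule \<kappa>)
    show "lplus ?D (\<kappa> x) (\<kappa> y) = \<kappa> (x \<oplus> y)" using xy by (simp add: lg_alg_ops add')
    have "R (\<kappa> x) (\<kappa> x)" using xy Mz by (simp add: R)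
    then show "lle ?D (\<kappa> x) (\<kappa> y) \<longleftrightarrow> y \<oplus> \<ominus> x \<in> M"
      using xy by (auto simp: lle_def lg_alg_ops R[symmetric])
  qed
qed

section \<open>Separating an element from a divisible subgroup\<close>

lemma abelian_group_on_product:
  assumes "abelian_group_on S add neg zero" "abelian_group_on T add' neg' zero'"
  shows "abelian_group_on (S \<times> T) (\<lambda>x y. (add (fst x) (fst y), add' (snd x) (snd y)))
    (\<lambda>x. (neg (fst x), neg' (snd x))) (zero, zero')"
proof -
  interpret A: abelian_group_on S add neg zero by fact
  interpret B: abelian_group_on T add' neg' zero' by fact
  show ?thesis
    by unfold_locales
      (auto simp: A.add_assoc B.add_assoc intro: A.add_commute B.add_commute)
qed

lemma infinite_Times_injection:
  assumes "infinite S"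
  obtains \<psi> where "inj_on \<psi> (S \<times> S)" "\<psi> ` (S \<times> S) \<subseteq> S"
proof -
  have "\<exists>f. inj_on f (S \<times> S) \<and> f ` (S \<times> S) \<subseteq> S"
    unfolding card_of_ordLeq by (rule ordIso_imp_ordLeq[OF card_of_Times_same_infinite[OF assms]])
  then show thesis using that by (elim exE conjE)
qed

text \<open>A group homomorphism that is monotone for the order modulo a prime ideal preserves meets: one of
  the arguments is equal to the meet modulo the ideal.\<close>

lemma hom_modulo_primeI:
  fixes A :: "('s lg_sym, 'u) alg" and D :: "('s lg_sym, 'v) alg"
  defines "prime \<equiv> lattice_group_on.prime_ideal (carrier A) (lplus A) (lzero A) (lmeet A)"
    and "nonneg \<equiv> lattice_group_on.nonneg_mod (carrier A) (lplus A) (lzero A) (lmeet A)"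
  assumes A: "A \<in> lAG" and D: "D \<in> lAG" and I: "prime I"
    and h: "\<And>x. x \<in> carrier A \<Longrightarrow> h x \<in> carrier D"
    and plus: "\<And>x y. x \<in> carrier A \<Longrightarrow> y \<in> carrier A \<Longrightarrow> h (lplus A x y) = lplus D (h x) (h y)"
    and mono: "\<And>x y. x \<in> carrier A \<Longrightarrow> y \<in> carrier A \<Longrightarrow> lplus A y (lminus A x) \<in> nonneg I \<Longrightarrow>
      lle D (h x) (h y)"
  shows "h \<in> hom lg_lang A D"
proof (rule lg_homI[OF A D h plus])
  interpret A: lattice_group_on "carrier A" "lplus A" "lminus A" "lzero A" "lmeet A" "ljoin A"
    using A by (simp add: lAG_iff)
  interpret D: lattice_group_on "carrier D" "lplus D" "lminus D" "lzero D" "lmeet D" "ljoin D"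
    using D by (simp add: lAG_iff)
  have I': "A.prime_ideal I" and Ii: "A.positive_ideal I"
    using I by (auto simp: prime_def A.prime_ideal_def)
  have mono': "D.le (h x) (h y)"
    if "x \<in> carrier A" "y \<in> carrier A" "lplus A y (lminus A x) \<in> A.nonneg_mod I" for x y
    using mono that by (simp add: lle_def D.le_def nonneg_def)
  fix x y assume xy: "x \<in> carrier A" "y \<in> carrier A"
  have m: "lmeet A x y \<in> carrier A" "h x \<in> carrier D" "h y \<in> carrier D" "h (lmeet A x y) \<in> carrier D"
    using xy h by auto
  have le: "D.le (h u) (h v)" if "u \<in> carrier A" "v \<in> carrier A" "A.le u v" for u v
    using that by (intro mono' A.nonneg_in_nonneg_mod[OF Ii]) (auto simp: A.nonneg_diff_iff)
  show "h (lmeet A x y) = lmeet D (h x) (h y)"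
  proof (rule D.le_antisym)
    show "D.le (h (lmeet A x y)) (lmeet D (h x) (h y))"
      using m xy by (intro D.meet_greatest le) auto
    have "D.le (h x) (h (lmeet A x y)) \<or> D.le (h y) (h (lmeet A x y))"
      using A.prime_ideal_meet[OF I' xy] mono' xy m by blast
    then show "D.le (lmeet D (h x) (h y)) (h (lmeet A x y))"
      using m D.le_trans[of "lmeet D (h x) (h y)" "h x"] D.le_trans[of "lmeet D (h x) (h y)" "h y"]
      by auto
  qed (use m in auto)
qed

text \<open>Let \<open>P, Q\<close> be the primes at which \<open>C\<close> does not interpolate \<open>b\<close>. Order the group \<open>A \<times> A\<close> by the
  cone generated by \<open>nonneg_mod P \<times> nonneg_mod Q\<close> and the pairs \<open>(c, -c)\<close>, \<open>c \<in> C\<close>. Divisibility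
  of \<open>C\<close> keeps all positive multiples of \<open>(-b, b)\<close> out of the cone, so some total preorder extends it and leaves \<open>(-b, b)\<close>
  non-positive. In the resulting chain \<open>(b, 0)\<close> and \<open>(0, b)\<close> differ, \<open>(c, 0)\<close> and \<open>(0, c)\<close> agree, and both
  embeddings are lattice homomorphisms since \<open>P\<close> and \<open>Q\<close> are prime.\<close>

lemma divisible_sublattice_group_dominion:
  fixes A :: "('s lg_sym, 'u) alg"
  assumes A: "A \<in> lAG" and CA: "C \<subseteq> carrier A" and b: "b \<in> carrier A" "b \<notin> C"
    and C0: "lzero A \<in> C"
    and Cp: "\<And>c d. c \<in> C \<Longrightarrow> d \<in> C \<Longrightarrow> lplus A c d \<in> C"
    and Cn: "\<And>c. c \<in> C \<Longrightarrow> lminus A c \<in> C"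
    and Cm: "\<And>c d. c \<in> C \<Longrightarrow> d \<in> C \<Longrightarrow> lmeet A c d \<in> C"
    and Cj: "\<And>c d. c \<in> C \<Longrightarrow> d \<in> C \<Longrightarrow> ljoin A c d \<in> C"
    and Cd: "\<And>c n. c \<in> C \<Longrightarrow> n \<ge> 1 \<Longrightarrow> \<exists>d\<in>C. nmult A n d = c"
  obtains D :: "('s lg_sym, 'u) alg" and h k where "D \<in> lAG" "h \<in> hom lg_lang A D" "k \<in> hom lg_lang A D"
    "\<And>c. c \<in> C \<Longrightarrow> h c = k c" "h b \<noteq> k b"
proof -
  let ?S = "carrier A"
  interpret A: lattice_group_on ?S "lplus A" "lminus A" "lzero A" "lmeet A" "ljoin A"
    using A by (simp add: lAG_iff)
  have small: "?S \<prec> (UNIV :: 'u set)" using A by (simp add: lAG_iff small_algebras_def)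
  have inf: "infinite ?S" using A.infinite_if_nonzero[of b] b C0 by blast
  obtain P Q where P: "A.prime_ideal P" and Q: "A.prime_ideal Q"
    and PQ: "\<And>c. c \<in> C \<Longrightarrow> lplus A c (lminus A b) \<in> A.nonneg_mod P \<Longrightarrow>
      lplus A b (lminus A c) \<in> A.nonneg_mod Q \<Longrightarrow> False"
    using A.prime_ideals_separating[OF CA b Cm Cj] by metis
  have Pi: "A.positive_ideal P" and Qi: "A.positive_ideal Q"
    using P Q by (auto simp: A.prime_ideal_def)
  let ?U = "A.nonneg_mod P" and ?V = "A.nonneg_mod Q"
  have U: "A.submonoid ?U" and V: "A.submonoid ?V"
    using A.submonoid_nonneg_mod Pi Qi by auto
  let ?add = "\<lambda>x y. (lplus A (fst x) (fst y), lplus A (snd x) (snd y))"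
  let ?neg = "\<lambda>x. (lminus A (fst x), lminus A (snd x))"
  interpret G: abelian_group_on "?S \<times> ?S" ?add ?neg "(lzero A, lzero A)"
    by (rule abelian_group_on_product) unfold_locales
  have Gmult: "G.mult n (x, y) = (A.mult n x, A.mult n y)" for n x y
    by (induction n) auto
  define M0 where "M0 = {(x, y). x \<in> ?S \<and> y \<in> ?S \<and>
    (\<exists>c\<in>C. lplus A x c \<in> ?U \<and> lplus A y (lminus A c) \<in> ?V)}"
  have M0: "G.submonoid M0"
    unfolding G.submonoid_def
  proof (intro conjI ballI)
    show "M0 \<subseteq> ?S \<times> ?S" by (auto simp: M0_def)
    show "(lzero A, lzero A) \<in> M0"
      using C0 U V by (auto simp: M0_def A.submonoid_def intro!: bexI[of _ "lzero A"])
  next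
    fix u v assume "u \<in> M0" "v \<in> M0"
    then obtain x y c x' y' c' where *:
      "u = (x, y)" "x \<in> ?S" "y \<in> ?S" "c \<in> C" "lplus A x c \<in> ?U" "lplus A y (lminus A c) \<in> ?V"
      "v = (x', y')" "x' \<in> ?S" "y' \<in> ?S" "c' \<in> C" "lplus A x' c' \<in> ?U" "lplus A y' (lminus A c') \<in> ?V"
      by (auto simp: M0_def)
    have S: "c \<in> ?S" "c' \<in> ?S" using * CA by auto
    have "lplus A (lplus A x c) (lplus A x' c') \<in> ?U"
      "lplus A (lplus A y (lminus A c)) (lplus A y' (lminus A c')) \<in> ?V"
      using U V * by (auto simp: A.submonoid_def)
    then have "lplus A (lplus A x x') (lplus A c c') \<in> ?U"
      "lplus A (lplus A y y') (lminus A (lplus A c c')) \<in> ?V"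
      using * S by (simp_all add: A.add_ac A.neg_distrib)
    then show "?add u v \<in> M0" using * Cp by (auto simp: M0_def)
  qed
  let ?w = "(lminus A b, b)"
  have wS: "?w \<in> ?S \<times> ?S" using b by simp
  have av: "G.mult n ?w \<notin> M0" if n: "n \<ge> 1" for n
  proof
    assume "G.mult n ?w \<in> M0"
    then obtain c where c: "c \<in> C" "lplus A (A.mult n (lminus A b)) c \<in> ?U"
      "lplus A (A.mult n b) (lminus A c) \<in> ?V" by (auto simp: M0_def Gmult)
    obtain d where d: "d \<in> C" "c = A.mult n d"
      using Cd[OF c(1) n] by (auto simp: nmult_def A.mult_def)
    have dS: "d \<in> ?S" using d CA by auto
    have "A.mult n (lplus A d (lminus A b)) \<in> ?U" "A.mult n (lplus A b (lminus A d)) \<in> ?V"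
      using c dS b by (simp_all add: d A.mult_add A.mult_neg A.add_commute)
    then show False
      using PQ[OF d(1)] A.nonneg_mod_of_mult[OF Pi _ n] A.nonneg_mod_of_mult[OF Qi _ n] dS b by auto
  qed
  obtain M where M: "G.submonoid M" "M0 \<subseteq> M" "?w \<notin> M"
    and total: "\<And>x. x \<in> ?S \<times> ?S \<Longrightarrow> x \<in> M \<or> ?neg x \<in> M"
    using G.total_submonoid_avoiding[OF M0 wS av] by blast
  have UM: "(x, lzero A) \<in> M" if "x \<in> ?U" for x
  proof -
    have "x \<in> ?S" using that by (simp add: A.nonneg_mod_def)
    then have "(x, lzero A) \<in> M0"
      using that C0 V by (auto simp: M0_def A.submonoid_def intro!: bexI[of _ "lzero A"])
    then show ?thesis using M by blast
  qed
  have VM: "(lzero A, x) \<in> M" if "x \<in> ?V" for x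
  proof -
    have "x \<in> ?S" using that by (simp add: A.nonneg_mod_def)
    then have "(lzero A, x) \<in> M0"
      using that C0 U by (auto simp: M0_def A.submonoid_def intro!: bexI[of _ "lzero A"])
    then show ?thesis using M by blast
  qed
  have CM: "(lminus A c, c) \<in> M" if "c \<in> C" for c
  proof -
    have "(lminus A c, c) \<in> M0"
      using that CA U V by (auto simp: M0_def A.submonoid_def subset_iff intro!: bexI[of _ c])
    then show ?thesis using M by blast
  qed
  \<comment> \<open>\<open>b\<close> is nonzero, so the carrier is infinite and \<open>D\<close> can be built inside it.\<close>
  obtain \<psi> where \<psi>: "inj_on \<psi> (?S \<times> ?S)" "\<psi> ` (?S \<times> ?S) \<subseteq> ?S"
    using infinite_Times_injection[OF inf] by blast
  have small': "\<psi> ` (?S \<times> ?S) \<prec> (UNIV :: 'u set)"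
    using small \<psi>(2) lesspoll_trans1 subset_imp_lepoll by blast
  obtain D :: "('s lg_sym, 'u) alg" and \<kappa> where D: "D \<in> lAG" "carrier D = \<kappa> ` (?S \<times> ?S)"
    and \<kappa>: "\<And>x y. x \<in> ?S \<times> ?S \<Longrightarrow> y \<in> ?S \<times> ?S \<Longrightarrow>
      \<kappa> x = \<kappa> y \<longleftrightarrow> ?add x (?neg y) \<in> M \<and> ?add y (?neg x) \<in> M"
    and Dplus: "\<And>x y. x \<in> ?S \<times> ?S \<Longrightarrow> y \<in> ?S \<times> ?S \<Longrightarrow> lplus D (\<kappa> x) (\<kappa> y) = \<kappa> (?add x y)"
    and Dle: "\<And>x y. x \<in> ?S \<times> ?S \<Longrightarrow> y \<in> ?S \<times> ?S \<Longrightarrow> lle D (\<kappa> x) (\<kappa> y) \<longleftrightarrow> ?add y (?neg x) \<in> M"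
    by (rule G.total_quotient[OF M(1) _ \<psi>(1) small'])
      (rule total, assumption, (rule that; assumption))
  show thesis
  proof (rule that[OF D(1)])
    show "(\<lambda>x. \<kappa> (x, lzero A)) \<in> hom lg_lang A D"
      by (rule hom_modulo_primeI[OF A D(1) P]) (auto simp: D(2) Dplus Dle UM)
    show "(\<lambda>x. \<kappa> (lzero A, x)) \<in> hom lg_lang A D"
      by (rule hom_modulo_primeI[OF A D(1) Q]) (auto simp: D(2) Dplus Dle VM)
    show "\<kappa> (c, lzero A) = \<kappa> (lzero A, c)" if "c \<in> C" for c
      using that CA CM[OF that] CM[OF Cn[OF that]] by (auto simp: \<kappa> subset_iff)
    show "\<kappa> (b, lzero A) \<noteq> \<kappa> (lzero A, b)"
      using b M(3) by (auto simp: \<kappa>)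
  qed
qed

section \<open>Equational classes\<close>

lemma eval_closed:
  assumes A: "algebra L A" and "wf_trm L V t" and "\<And>i. i \<in> V \<Longrightarrow> e i \<in> carrier A"
  shows "eval A e t \<in> carrier A"
  using assms(2)
proof (induction t)
  case (Var i)
  then show ?case using assms(3) by simp
next
  case (Fn s ts)
  then have "L s = Some (length (map (eval A e) ts))" "set (map (eval A e) ts) \<subseteq> carrier A" by auto
  then show ?case using A unfolding algebra_def by (metis eval.simps(2))
qed

lemma eval_hom:
  assumes A: "algebra L A" and h: "h \<in> hom L A B" and "wf_trm L V t"
    and e: "\<And>i. i \<in> V \<Longrightarrow> e i \<in> carrier A"
  shows "h (eval A e t) = eval B (\<lambda>i. h (e i)) t"
  using assms(3)
proof (induction t)
  case (Fn s ts)
  have "L s = Some (length (map (eval A e) ts))" "set (map (eval A e) ts) \<subseteq> carrier A"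
    using Fn.prems eval_closed[OF A _ e] by auto
  then have "h (interp A s (map (eval A e) ts)) = interp B s (map h (map (eval A e) ts))"
    using h unfolding hom_def by blast
  also have "map h (map (eval A e) ts) = map (eval B (\<lambda>i. h (e i))) ts"
    using Fn by simp
  finally show ?case by simp
qed simp

lemma carrier_reduct [simp]: "carrier (reduct L A) = carrier A"
  and interp_reduct [simp]: "s \<in> dom L \<Longrightarrow> interp (reduct L A) s = interp A s"
  by (simp_all add: reduct_def fun_eq_iff)

definition satisfies :: "('f, 'u) alg \<Rightarrow> ('f trm \<times> 'f trm) set \<Rightarrow> bool" where
  "satisfies A E \<longleftrightarrow> (\<forall>(s, t)\<in>E. \<forall>e. range e \<subseteq> carrier A \<longrightarrow> eval A e s = eval A e t)"

definition equations :: "'f lang \<Rightarrow> ('f trm \<times> 'f trm) set \<Rightarrow> bool" where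
  "equations L E \<longleftrightarrow> (\<forall>(s, t)\<in>E. wf_trm L UNIV s \<and> wf_trm L UNIV t)"

lemma satisfies_image:
  assumes E: "equations L E" and A: "algebra L A" "satisfies A E"
    and h: "h \<in> hom L A B" "h ` carrier A = carrier B"
  shows "satisfies B E"
  unfolding satisfies_def
proof (clarify)
  fix s t and e :: "nat \<Rightarrow> 'c" assume st: "(s, t) \<in> E" and e: "range e \<subseteq> carrier B"
  define d where "d i = inv_into (carrier A) h (e i)" for i
  have "e i \<in> h ` carrier A" for i using e h(2) by auto
  then have d: "range d \<subseteq> carrier A" and hd: "(\<lambda>i. h (d i)) = e"
    by (auto simp: d_def inv_into_into f_inv_into_f)
  have "h (eval A d s) = h (eval A d t)" using A(2) st d by (auto simp: satisfies_def)
  moreover have "wf_trm L UNIV s" "wf_trm L UNIV t" using E st by (auto simp: equations_def)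
  ultimately show "eval B e s = eval B e t"
    using eval_hom[OF A(1) h(1), of UNIV s d] eval_hom[OF A(1) h(1), of UNIV t d] d hd
    by (simp add: image_subset_iff)
qed

text \<open>Covers subalgebras (a single inclusion) as well as products (all projections).\<close>

lemma satisfies_if_homs_separate:
  assumes E: "equations L E" and A: "algebra L A"
    and h: "\<And>i. i \<in> I \<Longrightarrow> h i \<in> hom L A (B i)" and B: "\<And>i. i \<in> I \<Longrightarrow> satisfies (B i) E"
    and sep: "\<And>x y. x \<in> carrier A \<Longrightarrow> y \<in> carrier A \<Longrightarrow> (\<And>i. i \<in> I \<Longrightarrow> h i x = h i y) \<Longrightarrow> x = y"
  shows "satisfies A E"
  unfolding satisfies_def
proof (clarify)
  fix s t and e :: "nat \<Rightarrow> 'b" assume st: "(s, t) \<in> E" and e: "range e \<subseteq> carrier A"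
  have wf: "wf_trm L UNIV s" "wf_trm L UNIV t" using E st by (auto simp: equations_def)
  show "eval A e s = eval A e t"
  proof (rule sep)
    show "eval A e s \<in> carrier A" "eval A e t \<in> carrier A"
      using eval_closed[OF A] wf e by blast+
    fix i assume i: "i \<in> I"
    have "range (\<lambda>j. h i (e j)) \<subseteq> carrier (B i)" using h[OF i] e by (auto simp: hom_def)
    then have "eval (B i) (\<lambda>j. h i (e j)) s = eval (B i) (\<lambda>j. h i (e j)) t"
      using B[OF i] st by (auto simp: satisfies_def)
    then show "h i (eval A e s) = h i (eval A e t)"
      using eval_hom[OF A h[OF i] wf(1), of e] eval_hom[OF A h[OF i] wf(2), of e] e
      by (simp add: image_subset_iff)
  qed
qed

lemma variety_equational:
  fixes L :: "'f lang"
  assumes E: "equations L E"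
  shows "variety L {A \<in> (small_algebras L :: ('f, 'u) alg set). satisfies A E}" (is "variety L ?K")
  unfolding variety_def
proof (intro conjI subsetI)
  fix B assume "B \<in> Him L ?K"
  then obtain A h where *: "algebra L B" "A \<in> ?K" "h \<in> hom L A B" "h ` carrier A = carrier B"
    by (auto simp: Him_def)
  have "carrier B \<lesssim> carrier A" using image_lepoll[of h "carrier A"] * by simp
  then have "B \<in> small_algebras L" using * lesspoll_trans1 by (auto simp: small_algebras_def)
  moreover have "satisfies B E"
    using satisfies_image[OF E _ _ *(3,4)] * by (auto simp: small_algebras_def)
  ultimately show "B \<in> ?K" by simp
next
  fix A assume "A \<in> Sub L ?K"
  then obtain B where *: "B \<in> ?K" "subalgebra L A B" by (auto simp: Sub_def)
  have "carrier A \<lesssim> carrier B" using * by (auto simp: subalgebra_def intro: subset_imp_lepoll)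
  then have "A \<in> small_algebras L"
    using * lesspoll_trans1 by (auto simp: small_algebras_def subalgebra_def)
  moreover have "satisfies A E"
    by (rule satisfies_if_homs_separate[OF E, of A "{()}" "\<lambda>_. id" "\<lambda>_. B"])
      (use * in \<open>auto simp: subalgebra_def hom_def\<close>)
  ultimately show "A \<in> ?K" by simp
next
  fix B assume "B \<in> Prod L ?K"
  then obtain I :: "'u set" and A h where *: "B \<in> small_algebras L" "\<And>i. i \<in> I \<Longrightarrow> A i \<in> ?K"
    "h \<in> hom L B (prod_alg L I A)" "bij_betw h (carrier B) (carrier (prod_alg L I A))"
    unfolding Prod_def isomorphic_def by blast
  have hB: "h x \<in> (\<Pi>\<^sub>E i\<in>I. carrier (A i))" if "x \<in> carrier B" for x
    using *(3) that by (auto simp: hom_def prod_alg_def)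
  have "satisfies B E"
  proof (rule satisfies_if_homs_separate[OF E])
    show "algebra L B" using * by (simp add: small_algebras_def)
    fix i assume i: "i \<in> I"
    show "satisfies (A i) E" using * i by auto
    have "h (interp B s xs) i = interp (A i) s (map (\<lambda>x. h x i) xs)"
      if "L s = Some (length xs)" "set xs \<subseteq> carrier B" for s xs
    proof -
      have "h (interp B s xs) = interp (prod_alg L I A) s (map h xs)"
        using *(3) that unfolding hom_def by blast
      moreover have "set (map h xs) \<subseteq> (\<Pi>\<^sub>E i\<in>I. carrier (A i))" using hB that by auto
      ultimately show ?thesis using that i by (simp add: prod_alg_def comp_def)
    qed
    then show "(\<lambda>x. h x i) \<in> hom L B (A i)" using hB i by (auto simp: hom_def PiE_iff)
  next
    fix x y assume xy: "x \<in> carrier B" "y \<in> carrier B" and eq: "\<And>i. i \<in> I \<Longrightarrow> h x i = h y i"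
    have "h x = h y" using PiE_ext[OF hB hB] xy eq by blast
    then show "x = y" using *(4) xy by (auto simp: bij_betw_def dest: inj_onD)
  qed
  then show "B \<in> ?K" using * by simp
qed auto

section \<open>Equations of Abelian lattice-ordered groups and of division\<close>

abbreviation "plus_trm s t \<equiv> Fn Plus [s, t]"
abbreviation "meet_trm s t \<equiv> Fn Meet [s, t]"
abbreviation "join_trm s t \<equiv> Fn Join [s, t]"

text \<open>Translation invariance of the order is a quasi-equation; it amounts to distributivity of
  addition over meets.\<close>

definition lg_equations :: "('s lg_sym trm \<times> 's lg_sym trm) set" where
  "lg_equations = (let x = Var 0; y = Var 1; z = Var 2; zero = Fn Zero [] in
    {(plus_trm (plus_trm x y) z, plus_trm x (plus_trm y z)), (plus_trm x y, plus_trm y x),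
     (plus_trm x zero, x), (plus_trm x (Fn Minus [x]), zero),
     (meet_trm (meet_trm x y) z, meet_trm x (meet_trm y z)), (meet_trm x y, meet_trm y x),
     (join_trm (join_trm x y) z, join_trm x (join_trm y z)), (join_trm x y, join_trm y x),
     (meet_trm x (join_trm x y), x), (join_trm x (meet_trm x y), x),
     (plus_trm (meet_trm x y) z, meet_trm (plus_trm x z) (plus_trm y z))})"

lemma satisfies_lg_equations_iff:
  "satisfies A lg_equations \<longleftrightarrow> (\<forall>x\<in>carrier A. \<forall>y\<in>carrier A. \<forall>z\<in>carrier A.
        lplus A (lplus A x y) z = lplus A x (lplus A y z) \<and>
        lplus A x y = lplus A y x \<and>
        lplus A x (lzero A) = x \<and>
        lplus A x (lminus A x) = lzero A \<and>
        lmeet A (lmeet A x y) z = lmeet A x (lmeet A y z) \<and>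
        lmeet A x y = lmeet A y x \<and>
        ljoin A (ljoin A x y) z = ljoin A x (ljoin A y z) \<and>
        ljoin A x y = ljoin A y x \<and>
        lmeet A x (ljoin A x y) = x \<and>
        ljoin A x (lmeet A x y) = x \<and>
        lplus A (lmeet A x y) z = lmeet A (lplus A x z) (lplus A y z))"
    (is "_ \<longleftrightarrow> (\<forall>x\<in>_. \<forall>y\<in>_. \<forall>z\<in>_. ?P x y z)")
proof -
  have "satisfies A lg_equations \<longleftrightarrow> (\<forall>e :: nat \<Rightarrow> _. range e \<subseteq> carrier A \<longrightarrow> ?P (e 0) (e 1) (e 2))"
    unfolding satisfies_def lg_equations_def Let_def
    by (simp add: lplus_def lminus_def lzero_def lmeet_def ljoin_def all_conj_distrib imp_conjR)
  also have "\<dots> \<longleftrightarrow> (\<forall>x\<in>carrier A. \<forall>y\<in>carrier A. \<forall>z\<in>carrier A. ?P x y z)"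
  proof (intro iffI ballI)
    fix x y z
    assume all: "\<forall>e :: nat \<Rightarrow> _. range e \<subseteq> carrier A \<longrightarrow> ?P (e 0) (e 1) (e 2)"
      and xyz: "x \<in> carrier A" "y \<in> carrier A" "z \<in> carrier A"
    define e where "e i = (if i = 0 then x else if i = 1 then y else z)" for i :: nat
    have "e 0 = x" "e 1 = y" "e 2 = z" "range e \<subseteq> carrier A" using xyz by (auto simp: e_def)
    with all show "?P x y z" by metis
  next
    assume all: "\<forall>x\<in>carrier A. \<forall>y\<in>carrier A. \<forall>z\<in>carrier A. ?P x y z"
    show "\<forall>e :: nat \<Rightarrow> _. range e \<subseteq> carrier A \<longrightarrow> ?P (e 0) (e 1) (e 2)"
    proof (intro allI impI)
      fix e :: "nat \<Rightarrow> 'b" assume "range e \<subseteq> carrier A"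
      then have "e 0 \<in> carrier A" "e 1 \<in> carrier A" "e 2 \<in> carrier A" by auto
      with all show "?P (e 0) (e 1) (e 2)" by blast
    qed
  qed
  finally show ?thesis .
qed

lemma lAG_equational: "lAG = {A \<in> small_algebras lg_lang. satisfies A lg_equations}"
proof (intro equalityI subsetI)
  fix A :: "('s lg_sym, 'u) alg" assume A: "A \<in> lAG"
  then interpret lattice_group_on "carrier A" "lplus A" "lminus A" "lzero A" "lmeet A" "ljoin A"
    by (simp add: lAG_iff)
  have "satisfies A lg_equations"
    unfolding satisfies_lg_equations_iff
    by (auto simp: add_assoc meet_assoc join_assoc meet_join join_meet meet_add
        intro: add_commute meet_commute join_commute)
  then show "A \<in> {A \<in> small_algebras lg_lang. satisfies A lg_equations}"
    using A by (simp add: lAG_def)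
next
  fix A :: "('s lg_sym, 'u) alg"
  assume "A \<in> {A \<in> small_algebras lg_lang. satisfies A lg_equations}"
  then have A: "A \<in> small_algebras lg_lang" and eqs: "satisfies A lg_equations" by auto
  note eqs = eqs[unfolded satisfies_lg_equations_iff]
  show "A \<in> lAG"
    unfolding lAG_def lle_def using A
    by (intro CollectI conjI ballI impI) (use eqs in metis)+
qed

lemma equations_lg: "equations lg_lang lg_equations"
  by (simp add: equations_def lg_equations_def Let_def)

definition mult_trm :: "nat \<Rightarrow> 's lg_sym trm \<Rightarrow> 's lg_sym trm" where
  "mult_trm n t = (plus_trm t ^^ n) (Fn Zero [])"

lemma eval_mult_trm: "eval A e (mult_trm n t) = nmult A n (eval A e t)"
proof -
  have "eval A e ((plus_trm t ^^ n) (Fn Zero [])) = (lplus A (eval A e t) ^^ n) (lzero A)"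
    by (induction n) (auto simp: lplus_def lzero_def)
  then show ?thesis by (simp add: mult_trm_def nmult_def)
qed

lemma wf_mult_trm:
  assumes "L Plus = Some 2" "L Zero = Some 0" "wf_trm L V t"
  shows "wf_trm L V (mult_trm n t)"
  unfolding mult_trm_def using assms by (induction n) auto

lemma lg_hom_ops:
  assumes "h \<in> hom lg_lang A B"
  shows "x \<in> carrier A \<Longrightarrow> h x \<in> carrier B"
    and "x \<in> carrier A \<Longrightarrow> y \<in> carrier A \<Longrightarrow> h (lplus A x y) = lplus B (h x) (h y)"
    and "h (lzero A) = lzero B"
proof -
  have h: "h (interp A s xs) = interp B s (map h xs)"
    if "lg_lang s = Some (length xs)" "set xs \<subseteq> carrier A" for s xs
    using assms that unfolding hom_def by blast
  show "x \<in> carrier A \<Longrightarrow> h x \<in> carrier B" using assms by (auto simp: hom_def)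
  show "h (lzero A) = lzero B" using h[of Zero "[]"] by (simp add: lzero_def)
  show "x \<in> carrier A \<Longrightarrow> y \<in> carrier A \<Longrightarrow> h (lplus A x y) = lplus B (h x) (h y)"
    using h[of Plus "[x, y]"] by (simp add: lplus_def)
qed

lemma nmult_mult: "nmult A n = abelian_group_on.mult (lplus A) (lzero A) n" if "A \<in> lAG"
proof -
  interpret lattice_group_on "carrier A" "lplus A" "lminus A" "lzero A" "lmeet A" "ljoin A"
    using that by (simp add: lAG_iff)
  show ?thesis by (auto simp: fun_eq_iff nmult_def mult_def)
qed

lemma nmult_hom:
  assumes A: "A \<in> lAG" and h: "h \<in> hom lg_lang A B" and x: "x \<in> carrier A"
  shows "h (nmult A n x) = nmult B n (h x)"
proof -
  interpret A: lattice_group_on "carrier A" "lplus A" "lminus A" "lzero A" "lmeet A" "ljoin A"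
    using A by (simp add: lAG_iff)
  have "h (A.mult n x) = (lplus B (h x) ^^ n) (lzero B)"
    by (induction n) (use lg_hom_ops[OF h] x in auto)
  then show ?thesis by (simp add: nmult_mult[OF A] nmult_def[of B])
qed

section \<open>Division is an extendable implicit operation\<close>

lemma component_div_op_iff:
  assumes A: "A \<in> lAG" and n: "n \<ge> 1"
  shows "component (div_op n) A as = Some b \<longleftrightarrow>
    as \<in> tuples A 1 \<and> b \<in> carrier A \<and> nmult A n b = as ! 0"
proof -
  interpret A: lattice_group_on "carrier A" "lplus A" "lminus A" "lzero A" "lmeet A" "ljoin A"
    using A by (simp add: lAG_iff)
  have the: "(THE b. b \<in> carrier A \<and> nmult A n b = a) = b" if "b \<in> carrier A" "nmult A n b = a" for a b
    using that A.mult_inject[OF _ _ n] unfolding nmult_mult[OF A] by (intro the_equality) auto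
  show ?thesis
  proof
    assume "component (div_op n) A as = Some b"
    then obtain c where "as \<in> tuples A 1" "c \<in> carrier A" "nmult A n c = as ! 0"
      "b = (THE b. b \<in> carrier A \<and> nmult A n b = as ! 0)"
      by (auto simp: div_op_def split: if_splits)
    then show "as \<in> tuples A 1 \<and> b \<in> carrier A \<and> nmult A n b = as ! 0" by (simp add: the)
  next
    assume "as \<in> tuples A 1 \<and> b \<in> carrier A \<and> nmult A n b = as ! 0"
    then show "component (div_op n) A as = Some b" using A the[of b "as ! 0"] by (auto simp: div_op_def)
  qed
qed

lemma div_op_defined:
  assumes n: "n \<ge> 1"
  shows "pfun_defined_by lg_lang lAG (Eq (mult_trm n (Var 1)) (Var 0))
    (div_op n :: ('s lg_sym, 'u) pfun)"
proof -
  let ?\<phi> = "Eq (mult_trm n (Var 1)) (Var 0) :: 's lg_sym fm"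
  have sat: "sat A (asg (as @ [b])) ?\<phi> \<longleftrightarrow> nmult A n b = as ! 0" if "as \<in> tuples A 1"
    for as b and A :: "('s lg_sym, 'u) alg"
    using that by (simp add: tuples_def eval_mult_trm asg_def nth_append)
  have "functional_fm lg_lang (lAG :: ('s lg_sym, 'u) alg set) 1 ?\<phi>"
    unfolding functional_fm_def
  proof (intro conjI ballI impI)
    show "wf_fm lg_lang {..1} ?\<phi>" by (simp add: wf_mult_trm)
    fix A :: "('s lg_sym, 'u) alg" and as b c
    assume A: "A \<in> lAG" and *: "as \<in> tuples A 1" "b \<in> carrier A" "c \<in> carrier A"
      "sat A (asg (as @ [b])) ?\<phi> \<and> sat A (asg (as @ [c])) ?\<phi>"
    then have "component (div_op n) A as = Some b" "component (div_op n) A as = Some c"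
      using component_div_op_iff[OF A n] sat[OF *(1)] by blast+
    then show "b = c" by simp
  qed simp
  moreover have "defined_pfun lAG 1 ?\<phi> = (div_op n :: ('s lg_sym, 'u) pfun)"
    by (auto simp: defined_pfun_def div_op_def fun_eq_iff sat simp del: sat.simps One_nat_def)
  moreover have "arity (div_op n :: ('s lg_sym, 'u) pfun) = 1" by (simp add: div_op_def)
  ultimately show ?thesis by (simp add: pfun_defined_by_def del: One_nat_def)
qed

lemma div_op_preserved_by_homs: "n \<ge> 1 \<Longrightarrow> preserved_by_homs lg_lang lAG (div_op n)"
  unfolding preserved_by_homs_def
proof (intro ballI allI impI)
  fix A B h as b
  assume n: "n \<ge> 1" and A: "A \<in> lAG" and B: "B \<in> lAG" and h: "h \<in> hom lg_lang A B"
    and "component (div_op n) A as = Some b"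
  then have *: "as \<in> tuples A 1" "b \<in> carrier A" "nmult A n b = as ! 0"
    using component_div_op_iff[OF A n] by auto
  moreover from this have "nmult B n (h b) = map h as ! 0"
    using nmult_hom[OF A h, of b n] by (simp add: tuples_def)
  ultimately show "component (div_op n) B (map h as) = Some (h b)"
    using lg_hom_ops(1)[OF h] component_div_op_iff[OF B n] by (auto simp: tuples_def)
qed

definition image_alg :: "'f lang \<Rightarrow> ('u \<Rightarrow> 'v) \<Rightarrow> ('f, 'u) alg \<Rightarrow> ('f, 'v) alg" where
  "image_alg L j A =
    \<lparr>carrier = j ` carrier A,
     interp = (\<lambda>s xs. if L s = Some (length xs) \<and> set xs \<subseteq> j ` carrier A
       then j (interp A s (map (inv_into (carrier A) j) xs)) else undefined)\<rparr>"

lemma image_alg: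
  assumes A: "algebra L A" and j: "inj_on j (carrier A)"
  shows "algebra L (image_alg L j A)" "j \<in> hom L A (image_alg L j A)"
    "j ` carrier A = carrier (image_alg L j A)"
proof -
  have closed: "interp A s (map (inv_into (carrier A) j) xs) \<in> carrier A"
    if "L s = Some (length xs)" "set xs \<subseteq> j ` carrier A" for s xs
  proof -
    have "set (map (inv_into (carrier A) j) xs) \<subseteq> carrier A"
      using that by (auto intro: inv_into_into)
    then show ?thesis using A that unfolding algebra_def by (metis length_map)
  qed
  show "algebra L (image_alg L j A)"
    using A closed by (auto simp: algebra_def image_alg_def)
  have "map (inv_into (carrier A) j) (map j xs) = xs" if "set xs \<subseteq> carrier A" for xs
    using that j by (auto intro!: map_idI simp: subset_iff)
  then show "j \<in> hom L A (image_alg L j A)"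
    by (auto simp: hom_def image_alg_def simp del: map_map)
qed (simp add: image_alg_def)

text \<open>Room for extensions: a universe with a complement of \<open>S\<close> smaller than \<open>S\<close> would be the union of two
  sets smaller than itself.\<close>

lemma lepoll_Compl_if_lesspoll_UNIV:
  fixes S :: "'u set"
  assumes inf: "infinite S" and small: "S \<prec> (UNIV :: 'u set)"
  shows "S \<lesssim> - S"
proof (rule ccontr)
  have le: "X \<lesssim> Y \<longleftrightarrow> (card_of X, card_of Y) \<in> ordLeq" for X Y :: "'u set"
    by (simp add: lepoll_def card_of_ordLeq)
  have less: "X \<lesssim> Y \<longleftrightarrow> (card_of Y, card_of X) \<notin> ordLess" for X Y :: "'u set"
    by (simp add: le not_ordLess_iff_ordLeq card_of_Well_order)
  assume "\<not> S \<lesssim> - S"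
  then have "- S \<lesssim> S" unfolding le using ordLeq_total[OF card_of_Well_order card_of_Well_order] by blast
  then have "- S \<prec> (UNIV :: 'u set)" using small lesspoll_trans1 by blast
  then have "\<not> (UNIV :: 'u set) \<lesssim> - S" "\<not> (UNIV :: 'u set) \<lesssim> S"
    using small lesspoll_trans2[of _ UNIV] by blast+
  then have "(card_of (S \<union> - S), card_of (UNIV :: 'u set)) \<in> ordLess"
    unfolding less using card_of_Un_ordLess_infinite[of "UNIV :: 'u set" S "- S"] inf
    by (auto dest: finite_subset[OF subset_UNIV])
  then show False using less[of "UNIV :: 'u set" UNIV] by simp
qed

text \<open>Renaming the elements of \<open>A\<close> along \<open>j\<close> turns the embedding \<open>m\<close> of \<open>A\<close> into itself into an inclusion:
  \<open>j\<close> inverts \<open>m\<close> on its image and moves the other elements out of \<open>A\<close>.\<close>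

lemma self_embedding_as_inclusion:
  fixes A :: "('f, 'u) alg"
  assumes A: "A \<in> small_algebras L" and m: "m \<in> hom L A A" "inj_on m (carrier A)"
  obtains j where "inj_on j (carrier A)" "\<And>x. x \<in> carrier A \<Longrightarrow> j (m x) = x"
    "subalgebra L A (image_alg L j A)" "image_alg L j A \<in> small_algebras L"
proof -
  let ?S = "carrier A"
  have alg: "algebra L A" and small: "?S \<prec> (UNIV :: 'u set)" using A by (auto simp: small_algebras_def)
  have mS: "m ` ?S \<subseteq> ?S" using m by (auto simp: hom_def)
  obtain \<phi> where \<phi>: "inj_on \<phi> (?S - m ` ?S)" "\<phi> ` (?S - m ` ?S) \<subseteq> - ?S"
  proof (cases "finite ?S")
    case True
    then have empty: "?S - m ` ?S = {}" using endo_inj_surj[OF _ mS m(2)] by blast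
    show thesis by (rule that[of undefined]) (simp_all only: empty inj_on_empty image_empty empty_subsetI)
  next
    case False
    then obtain \<phi> where "inj_on \<phi> ?S" "\<phi> ` ?S \<subseteq> - ?S"
      using lepoll_Compl_if_lesspoll_UNIV[OF False small] by (auto simp: lepoll_def)
    then show thesis by (intro that[of \<phi>]) (auto intro: inj_on_subset)
  qed
  define j where "j y = (if y \<in> m ` ?S then inv_into ?S m y else \<phi> y)" for y
  have jm: "j (m x) = x" if "x \<in> ?S" for x using that m by (simp add: j_def)
  have j\<phi>: "j y \<notin> ?S" if "y \<in> ?S" "y \<notin> m ` ?S" for y using that \<phi> by (auto simp: j_def)
  have inj: "inj_on j ?S"
  proof (rule inj_onI)
    fix x y assume *: "x \<in> ?S" "y \<in> ?S" "j x = j y"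
    show "x = y"
    proof (cases "x \<in> m ` ?S \<or> y \<in> m ` ?S")
      case True
      then have "x \<in> m ` ?S" "y \<in> m ` ?S" using * j\<phi> jm by force+
      then show ?thesis using * jm by force
    next
      case False
      then show ?thesis using * \<phi>(1) by (auto simp: j_def dest: inj_onD)
    qed
  qed
  let ?B = "image_alg L j A"
  note B = image_alg[OF alg inj]
  have "?S \<subseteq> carrier ?B" using jm mS B(3) by (metis image_iff subsetI subset_iff)
  moreover have "interp A s xs = interp ?B s xs" if xs: "L s = Some (length xs)" "set xs \<subseteq> ?S" for s xs
  proof -
    have mxs: "set (map m xs) \<subseteq> ?S" "map j (map m xs) = xs"
      using xs mS jm by (auto intro!: map_idI)
    have "interp A s xs \<in> ?S" using alg xs by (simp add: algebra_def)
    then have "interp A s xs = j (m (interp A s xs))" by (simp add: jm)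
    also have "\<dots> = j (interp A s (map m xs))" using m(1) xs by (simp add: hom_def)
    also have "\<dots> = interp ?B s (map j (map m xs))"
    proof -
      have "L s = Some (length (map m xs))" using xs by simp
      then show ?thesis using B(2) mxs(1) unfolding hom_def by blast
    qed
    finally show ?thesis using mxs by simp
  qed
  ultimately have "subalgebra L A ?B" using alg B(1) by (simp add: subalgebra_def)
  moreover have "carrier ?B \<prec> (UNIV :: 'u set)"
    using small lesspoll_trans1[OF image_lepoll] B(3) by metis
  ultimately show thesis using that[of j] inj jm B(1) by (simp add: small_algebras_def)
qed

text \<open>Multiplication by \<open>n\<close> embeds \<open>A\<close> into itself, so \<open>A\<close> extends to a copy of itself in which every
  element of \<open>A\<close> is divisible by \<open>n\<close>.\<close>

lemma div_op_extendable:
  assumes n: "n \<ge> 1"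
  shows "extendable lg_lang lAG (div_op n)"
  unfolding extendable_def
proof (intro ballI)
  fix A :: "('s lg_sym, 'u) alg" and as
  assume A: "A \<in> lAG" and as: "as \<in> tuples A (arity (div_op n :: ('s lg_sym, 'u) pfun))"
  interpret A: lattice_group_on "carrier A" "lplus A" "lminus A" "lzero A" "lmeet A" "ljoin A"
    using A by (simp add: lAG_iff)
  have small: "A \<in> small_algebras lg_lang" and eqs: "satisfies A lg_equations"
    using A by (auto simp: lAG_equational)
  have alg: "algebra lg_lang A" using small by (simp add: small_algebras_def)
  have m: "A.mult n \<in> hom lg_lang A A"
    by (rule lg_homI[OF A A]) (auto simp: A.mult_add A.mult_meet)
  have inj: "inj_on (A.mult n) (carrier A)" using A.mult_inject[OF _ _ n] by (auto intro: inj_onI)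
  obtain j where j: "inj_on j (carrier A)" "\<And>x. x \<in> carrier A \<Longrightarrow> j (A.mult n x) = x"
    "subalgebra lg_lang A (image_alg lg_lang j A)" "image_alg lg_lang j A \<in> small_algebras lg_lang"
    using self_embedding_as_inclusion[OF small m inj] by metis
  let ?B = "image_alg lg_lang j A"
  note B = image_alg[OF alg j(1)]
  have BlAG: "?B \<in> lAG"
    using satisfies_image[OF equations_lg alg eqs B(2,3)] j(4) by (simp add: lAG_equational)
  have as': "length as = 1" "as ! 0 \<in> carrier A" "as \<in> tuples ?B 1"
    using as j(3) by (auto simp: tuples_def div_op_def subalgebra_def)
  have "nmult ?B n (j (as ! 0)) = as ! 0"
    using nmult_hom[OF A B(2) as'(2), of n] j(2)[OF as'(2)] by (simp add: nmult_mult[OF A])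
  then have "component (div_op n) ?B as = Some (j (as ! 0))"
    using as' B(3) by (auto simp: component_div_op_iff[OF BlAG n])
  then show "\<exists>B\<in>lAG. subalgebra lg_lang A B \<and> as \<in> dom (component (div_op n) B)"
    using BlAG j(3) by blast
qed

lemma div_ops_ext_eq: "div_ops \<subseteq> ext_eq lg_lang lAG"
proof
  fix f :: "('s lg_sym, 'u) pfun" assume "f \<in> div_ops"
  then obtain n where n: "f = div_op n" "n \<ge> 1" by (auto simp: div_ops_def)
  have "conj_eqs (Eq (mult_trm n (Var 1)) (Var 0) :: 's lg_sym fm)" by simp
  then show "f \<in> ext_eq lg_lang lAG"
    using div_op_defined[OF n(2)] div_op_preserved_by_homs[OF n(2)] div_op_extendable[OF n(2)]
    unfolding n ext_eq_def implicit_operation_def by blast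
qed

lemma ext_eq_subset_ext_pp: "ext_eq L K \<subseteq> ext_pp L K"
proof -
  have "pp_fm \<phi>" if "conj_eqs \<phi>" for \<phi> :: "'a fm" using that by (cases \<phi>) auto
  then show ?thesis unfolding ext_eq_def ext_pp_def by blast
qed

section \<open>Divisible Abelian lattice-ordered groups\<close>

definition div_equations ::
  "(('s lg_sym, 'u) pfun \<Rightarrow> 's lg_sym) \<Rightarrow> ('s lg_sym trm \<times> 's lg_sym trm) set" where
  "div_equations g = {(mult_trm n (Fn (g (div_op n)) [Var 0]), Var 0) | n. n \<ge> 1}"

lemma satisfies_div_equations_iff:
  "satisfies A (div_equations g) \<longleftrightarrow>
    (\<forall>n\<ge>1. \<forall>a\<in>carrier A. nmult A n (interp A (g (div_op n)) [a]) = a)"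
proof
  assume sat: "satisfies A (div_equations g)"
  show "\<forall>n\<ge>1. \<forall>a\<in>carrier A. nmult A n (interp A (g (div_op n)) [a]) = a"
  proof (intro allI impI ballI)
    fix n a assume "n \<ge> (1 :: nat)" "a \<in> carrier A"
    then have "(mult_trm n (Fn (g (div_op n)) [Var 0]), Var 0) \<in> div_equations g"
      by (auto simp: div_equations_def)
    then have "eval A (\<lambda>_. a) (mult_trm n (Fn (g (div_op n)) [Var 0])) = eval A (\<lambda>_. a) (Var 0)"
      using sat \<open>a \<in> carrier A\<close> by (auto simp: satisfies_def dest!: bspec)
    then show "nmult A n (interp A (g (div_op n)) [a]) = a" by (simp add: eval_mult_trm)
  qed
next
  assume "\<forall>n\<ge>1. \<forall>a\<in>carrier A. nmult A n (interp A (g (div_op n)) [a]) = a"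
  then show "satisfies A (div_equations g)"
    by (auto simp: satisfies_def div_equations_def eval_mult_trm image_subset_iff)
qed

lemma reduct_ops:
  "lplus (reduct lg_lang A) = lplus A" "lminus (reduct lg_lang A) = lminus A"
  "lzero (reduct lg_lang A) = lzero A" "lmeet (reduct lg_lang A) = lmeet A"
  "ljoin (reduct lg_lang A) = ljoin A"
  by (simp_all add: fun_eq_iff lplus_def lminus_def lzero_def lmeet_def ljoin_def domIff)

lemma satisfies_reduct: "satisfies (reduct lg_lang A) lg_equations \<longleftrightarrow> satisfies A lg_equations"
  by (simp add: satisfies_lg_equations_iff reduct_ops)

lemma nmult_reduct: "nmult (reduct lg_lang A) = nmult A"
  by (simp add: fun_eq_iff nmult_def reduct_ops)

context
  fixes g :: "('s lg_sym, 'u) pfun \<Rightarrow> 's lg_sym" and LF :: "'s lg_sym lang"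
  assumes exp: "expansion lg_lang div_ops g LF"
begin

lemma LF_lg: "s \<in> dom lg_lang \<Longrightarrow> LF s = lg_lang s"
  using exp by (simp add: expansion_def)

lemma LF_div: "n \<ge> 1 \<Longrightarrow> LF (g (div_op n)) = Some 1"
  using exp by (auto simp: expansion_def div_ops_def div_op_def)

lemma LF_lg_simps:
  "LF Plus = Some 2" "LF Minus = Some 1" "LF Zero = Some 0" "LF Meet = Some 2" "LF Join = Some 2"
  by (simp_all add: LF_lg domIff)

lemma equations_lDAG: "equations LF (lg_equations \<union> div_equations g)"
  by (auto simp: equations_def lg_equations_def Let_def LF_lg_simps div_equations_def LF_div
      intro!: wf_mult_trm)

lemma algebra_reduct: "algebra LF A \<Longrightarrow> algebra lg_lang (reduct lg_lang A)"
  using LF_lg by (auto simp: algebra_def reduct_def domIff)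

lemma expand_class_equational:
  "expand_class lg_lang lAG div_ops g LF =
    {A \<in> small_algebras LF. satisfies A (lg_equations \<union> div_equations g)}"
proof -
  have *: "(\<forall>f\<in>div_ops. \<forall>as\<in>tuples A (arity f).
      component f (reduct lg_lang A) as = Some (interp A (g f) as)) \<longleftrightarrow>
    satisfies A (div_equations g)"
    if A: "algebra LF A" "reduct lg_lang A \<in> lAG" for A
  proof -
    have "component (div_op n) (reduct lg_lang A) [a] = Some (interp A (g (div_op n)) [a]) \<longleftrightarrow>
        nmult A n (interp A (g (div_op n)) [a]) = a"
      if n: "n \<ge> 1" and a: "a \<in> carrier A" for n a
    proof -
      have "interp A (g (div_op n)) [a] \<in> carrier A"
        using A(1) LF_div[OF n] a by (simp add: algebra_def)
      then show ?thesis
        using a by (simp add: component_div_op_iff[OF A(2) n] nmult_reduct tuples_def)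
    qed
    moreover have "(\<forall>f\<in>div_ops. \<forall>as\<in>tuples A (arity f).
        component f (reduct lg_lang A) as = Some (interp A (g f) as)) \<longleftrightarrow>
      (\<forall>n\<ge>1. \<forall>a\<in>carrier A.
        component (div_op n) (reduct lg_lang A) [a] = Some (interp A (g (div_op n)) [a]))"
    proof -
      have "tuples A (arity (div_op n :: ('s lg_sym, 'u) pfun)) = (\<lambda>a. [a]) ` carrier A" for n
        by (auto simp: tuples_def div_op_def length_Suc_conv)
      then show ?thesis by (auto simp: div_ops_def)
    qed
    ultimately show ?thesis by (simp add: satisfies_div_equations_iff)
  qed
  have un: "satisfies A (E \<union> F) \<longleftrightarrow> satisfies A E \<and> satisfies A F"
    for A :: "('s lg_sym, 'u) alg" and E F by (auto simp: satisfies_def)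
  have "reduct lg_lang A \<in> lAG \<longleftrightarrow> A \<in> small_algebras LF \<and> satisfies A lg_equations"
    if "algebra LF A" for A :: "('s lg_sym, 'u) alg"
    using that algebra_reduct[OF that] by (simp add: lAG_equational satisfies_reduct)
      (simp add: small_algebras_def)
  then show ?thesis
    using * by (auto simp: expand_class_def un small_algebras_def)
qed

lemma lDAG_equational:
  "lDAG g LF = {A \<in> small_algebras LF. satisfies A (lg_equations \<union> div_equations g)}" (is "_ = ?V")
proof
  show "lDAG g LF \<subseteq> ?V"
  proof -
    have "variety LF ?V" by (rule variety_equational[OF equations_lDAG])
    then show ?thesis by (simp add: lDAG_def expand_class_equational variety_def)
  qed
  have "subalgebra LF A A" if "A \<in> ?V" for A using that by (simp add: subalgebra_def small_algebras_def)
  then show "?V \<subseteq> lDAG g LF" by (auto simp: lDAG_def expand_class_equational Sub_def)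
qed

text \<open>The values of terms at \<open>as\<close> form a divisible \<open>\<ell>\<close>-subgroup \<open>C\<close>. Homomorphisms that agree on \<open>C\<close>
  agree on \<open>as\<close>, hence on \<open>b\<close> since they preserve \<open>f\<close>; so \<open>b\<close> belongs to \<open>C\<close>.\<close>

lemma implicit_operation_term:
  assumes f: "implicit_operation lg_lang lAG f" and A: "A \<in> lDAG g LF"
    and fas: "component f (reduct lg_lang A) as = Some b"
  shows "\<exists>t. wf_trm LF {..<arity f} t \<and> b = eval A (asg as) t"
proof (rule ccontr)
  assume no: "\<nexists>t. wf_trm LF {..<arity f} t \<and> b = eval A (asg as) t"
  let ?R = "reduct lg_lang A"
  have alg: "algebra LF A" and eqs: "satisfies A lg_equations" "satisfies A (div_equations g)"
    and small: "A \<in> small_algebras LF"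
    using A by (auto simp: lDAG_equational small_algebras_def satisfies_def)
  have R: "?R \<in> lAG"
    using algebra_reduct[OF alg] eqs(1) small
    by (simp add: lAG_equational satisfies_reduct) (simp add: small_algebras_def)
  obtain \<phi> where \<phi>: "pfun_defined_by lg_lang lAG \<phi> f" and pres: "preserved_by_homs lg_lang lAG f"
    using f by (auto simp: implicit_operation_def)
  have "f = defined_pfun lAG (arity f) \<phi>" and func: "functional_fm lg_lang (lAG :: ('s lg_sym, 'u) alg set) (arity f) \<phi>"
    using \<phi> by (auto simp: pfun_defined_by_def)
  then have *: "component (defined_pfun lAG (arity f) \<phi>) ?R as = Some b" using fas by simp
  then have as: "as \<in> tuples ?R (arity f)" by (auto simp: defined_pfun_def split: if_splits)
  have b: "b \<in> carrier ?R"
  proof -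
    obtain c where c: "c \<in> carrier ?R" "sat ?R (asg (as @ [c])) \<phi>"
      using * by (auto simp: defined_pfun_def split: if_splits)
    then have "(THE b. b \<in> carrier ?R \<and> sat ?R (asg (as @ [b])) \<phi>) = c"
      using func R as unfolding functional_fm_def by (intro the_equality) blast+
    then show ?thesis using * c by (auto simp: defined_pfun_def split: if_splits)
  qed
  define T where "T = {t. wf_trm LF {..<arity f} t}"
  define C where "C = eval A (asg as) ` T"
  have asg: "asg as i \<in> carrier A" if "i \<in> {..<arity f}" for i
    using that as by (auto simp: tuples_def asg_def)
  have C: "C \<subseteq> carrier A"
    using eval_closed[OF alg, of "{..<arity f}" _ "asg as"] asg unfolding C_def T_def by blast
  have Fn: "interp A s (map (eval A (asg as)) ts) \<in> C"
    if "LF s = Some (length ts)" "set ts \<subseteq> T" for s ts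
    using that unfolding C_def T_def by (intro image_eqI[of _ _ "Fn s ts"]) auto
  have Fn1: "interp A s [c] \<in> C" if "LF s = Some 1" "c \<in> C" for s c
  proof -
    obtain t where "t \<in> T" "c = eval A (asg as) t" using \<open>c \<in> C\<close> by (auto simp: C_def)
    then show ?thesis using Fn[of s "[t]"] that by simp
  qed
  have Fn2: "interp A s [c, d] \<in> C" if "LF s = Some 2" "c \<in> C" "d \<in> C" for s c d
  proof -
    obtain t u where "t \<in> T" "c = eval A (asg as) t" "u \<in> T" "d = eval A (asg as) u"
      using \<open>c \<in> C\<close> \<open>d \<in> C\<close> by (auto simp: C_def)
    then show ?thesis using Fn[of s "[t, u]"] that by simp
  qed
  obtain D :: "('s lg_sym, 'u) alg" and h k where D: "D \<in> lAG" "h \<in> hom lg_lang ?R D" "k \<in> hom lg_lang ?R D"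
    "\<And>c. c \<in> C \<Longrightarrow> h c = k c" "h b \<noteq> k b"
  proof (rule divisible_sublattice_group_dominion[OF R])
    show "C \<subseteq> carrier ?R" using C by simp
    show "b \<notin> C" using no by (auto simp: C_def T_def)
    show "lzero ?R \<in> C" using Fn[of Zero "[]"] unfolding reduct_ops by (simp add: lzero_def LF_lg_simps)
    show "lplus ?R c d \<in> C" if "c \<in> C" "d \<in> C" for c d
      using that unfolding reduct_ops lplus_def by (intro Fn2) (simp_all add: LF_lg_simps)
    show "lmeet ?R c d \<in> C" if "c \<in> C" "d \<in> C" for c d
      using that unfolding reduct_ops lmeet_def by (intro Fn2) (simp_all add: LF_lg_simps)
    show "ljoin ?R c d \<in> C" if "c \<in> C" "d \<in> C" for c d
      using that unfolding reduct_ops ljoin_def by (intro Fn2) (simp_all add: LF_lg_simps)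
    show "lminus ?R c \<in> C" if "c \<in> C" for c
      using that unfolding reduct_ops lminus_def by (intro Fn1) (simp_all add: LF_lg_simps)
    show "\<exists>d\<in>C. nmult ?R n d = c" if c: "c \<in> C" and n: "n \<ge> 1" for c n
    proof -
      have "c \<in> carrier A" using c C by blast
      then have "nmult ?R n (interp A (g (div_op n)) [c]) = c"
        using eqs(2) n by (simp add: satisfies_div_equations_iff nmult_reduct)
      moreover have "interp A (g (div_op n)) [c] \<in> C"
        using c LF_div[OF n] by (intro Fn1)
      ultimately show ?thesis by blast
    qed
  qed (use b in auto)
  have "set as \<subseteq> C"
  proof
    fix x assume "x \<in> set as"
    then obtain i where "i < length as" "x = as ! i" by (auto simp: in_set_conv_nth)
    then have "x = eval A (asg as) (Var i)" "Var i \<in> T"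
      using as by (auto simp: asg_def T_def tuples_def)
    then show "x \<in> C" unfolding C_def by blast
  qed
  then have "map h as = map k as" using D(4) by auto
  moreover have "component f D (map h as) = Some (h b)" "component f D (map k as) = Some (k b)"
    using pres R D fas unfolding preserved_by_homs_def by blast+
  ultimately show False using D(5) by (metis option.inject)
qed

end

theorem theorem13p16:
  fixes g :: "('s lg_sym, 'u) pfun \<Rightarrow> 's lg_sym"
    and LF :: "'s lg_sym lang"
  assumes "expansion lg_lang div_ops g LF"
  shows "div_ops \<subseteq> ext_eq lg_lang (lAG :: ('s lg_sym, 'u) alg set) \<and>
    variety LF (lDAG g LF) \<and>
    equational_Beth_companion lg_lang lAG LF (lDAG g LF)"
proof (intro conjI)
  show ext: "div_ops \<subseteq> ext_eq lg_lang (lAG :: ('s lg_sym, 'u) alg set)" by (rule div_ops_ext_eq)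
  show "variety LF (lDAG g LF)"
    unfolding lDAG_equational[OF assms] by (rule variety_equational[OF equations_lDAG[OF assms]])
  have "equational_pp_expansion lg_lang lAG LF (lDAG g LF)"
    unfolding equational_pp_expansion_def using ext assms by (auto simp: lDAG_def)
  moreover have "pp_expansion lg_lang lAG LF (lDAG g LF)"
    unfolding pp_expansion_def lDAG_def using ext ext_eq_subset_ext_pp assms by blast
  moreover have "\<exists>T. (\<forall>t\<in>T. wf_trm LF {..<arity f} t) \<and>
      (\<forall>A\<in>lDAG g LF. \<forall>as\<in>dom (component f (reduct lg_lang A)). \<exists>t\<in>T.
        component f (reduct lg_lang A) as = Some (eval A (asg as) t))"
    if "implicit_operation lg_lang lAG f" for f :: "('s lg_sym, 'u) pfun"
    using implicit_operation_term[OF assms that]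
    by (intro exI[of _ "{t. wf_trm LF {..<arity f} t}"]) blast
  ultimately show "equational_Beth_companion lg_lang lAG LF (lDAG g LF)"
    by (simp add: equational_Beth_companion_def Beth_companion_def)
qed

end
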